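(* Let $n\ge1$ be an integer, let $F\in\mathbb{C}[x_1,\ldots,x_s]$ be a non-constant polynomial and $X=\mathbf{V}(F)\subset\mathbb{C}^s$. Let $p\in X$ and let $\mathfrak{m}_p$ be its corresponding maximal ideal in $\mathcal{O}_{X,p}$. Then $p$ is non-singular if and only if $$\dim_{\mathbb{C}}\mathfrak{m}_p/\mathfrak{m}_p^{n+1}=\binom{n+s-1}{s-1}-1.$$
   Context: $\mathcal{O}_{X,p}$ is the localization of $\mathbb{C}[x_1,\ldots,x_s]/\langle F\rangle$ at the maximal ideal of $p$; $p$ is non-singular if this local ring is regular. *)

theory Defs
  imports
    "HOL-Algebra.Ideal_Product"
    "HOL-Algebra.Ring_Divisibility"
    "HOL-Algebra.Embedded_Algebras"
    "HOL-Algebra.Algebraic_Closure_Type"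
    "HOL-Library.Poly_Mapping"
    "HOL-Library.Extended_Nat"
    "HOL-Analysis.Finite_Cartesian_Product"
begin

section \<open>Commutative algebra\<close>

subsection \<open>Localization\<close>

text \<open>
  The usual equivalence relation on fractions: \<open>a/s = b/t\<close> iff \<open>u (t a - s b) = 0\<close> for some
  \<open>u \<in> S\<close>.  No cancellation is assumed, so zero divisors are allowed both in \<open>R\<close> and in \<open>S\<close>.
\<close>

definition frac_rel :: "('a, 'm) ring_scheme \<Rightarrow> 'a set \<Rightarrow> (('a \<times> 'a) \<times> ('a \<times> 'a)) set" where
  "frac_rel R S = {((a, s), (b, t)). a \<in> carrier R \<and> s \<in> S \<and> b \<in> carrier R \<and> t \<in> S \<and>
     (\<exists>u\<in>S. u \<otimes>\<^bsub>R\<^esub> ((t \<otimes>\<^bsub>R\<^esub> a) \<ominus>\<^bsub>R\<^esub> (s \<otimes>\<^bsub>R\<^esub> b)) = \<zero>\<^bsub>R\<^esub>)}"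

definition fraction :: "('a, 'm) ring_scheme \<Rightarrow> 'a set \<Rightarrow> 'a \<Rightarrow> 'a \<Rightarrow> ('a \<times> 'a) set" where
  "fraction R S a s = frac_rel R S `` {(a, s)}"

text \<open>
  The operations take the class of all sums (products) of representatives; that this is a single
  class, computed by the usual formulas, is shown in \<open>fraction_add\<close> and \<open>fraction_mult\<close> below.
\<close>

definition localization :: "('a, 'm) ring_scheme \<Rightarrow> 'a set \<Rightarrow> ('a \<times> 'a) set ring" where
  "localization R S = \<lparr>
     carrier = (carrier R \<times> S) // frac_rel R S,
     monoid.mult = (\<lambda>A B. frac_rel R S ``
       {(a \<otimes>\<^bsub>R\<^esub> b, s \<otimes>\<^bsub>R\<^esub> t) | a s b t. (a, s) \<in> A \<and> (b, t) \<in> B}),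
     one = fraction R S \<one>\<^bsub>R\<^esub> \<one>\<^bsub>R\<^esub>,
     ring.zero = fraction R S \<zero>\<^bsub>R\<^esub> \<one>\<^bsub>R\<^esub>,
     add = (\<lambda>A B. frac_rel R S ``
       {((t \<otimes>\<^bsub>R\<^esub> a) \<oplus>\<^bsub>R\<^esub> (s \<otimes>\<^bsub>R\<^esub> b), s \<otimes>\<^bsub>R\<^esub> t) | a s b t. (a, s) \<in> A \<and> (b, t) \<in> B}) \<rparr>"

locale mult_subset = cring R for R (structure) and S +
  assumes S_sub: "S \<subseteq> carrier R"
    and S_one: "\<one> \<in> S"
    and S_mult: "s \<in> S \<Longrightarrow> t \<in> S \<Longrightarrow> s \<otimes> t \<in> S"
begin

lemma S_carr: "s \<in> S \<Longrightarrow> s \<in> carrier R"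
  using S_sub by blast

lemma frac_rel_iff:
  "((a, s), (b, t)) \<in> frac_rel R S \<longleftrightarrow> a \<in> carrier R \<and> s \<in> S \<and> b \<in> carrier R \<and> t \<in> S \<and>
     (\<exists>u\<in>S. u \<otimes> (t \<otimes> a) = u \<otimes> (s \<otimes> b))"
proof -
  have "u \<otimes> (t \<otimes> a \<ominus> s \<otimes> b) = \<zero> \<longleftrightarrow> u \<otimes> (t \<otimes> a) = u \<otimes> (s \<otimes> b)"
    if "a \<in> carrier R" "s \<in> S" "b \<in> carrier R" "t \<in> S" "u \<in> S" for u
  proof -
    have c: "s \<in> carrier R" "t \<in> carrier R" "u \<in> carrier R"
      using that S_carr by auto
    have "u \<otimes> (t \<otimes> a \<ominus> s \<otimes> b) = u \<otimes> (t \<otimes> a) \<ominus> u \<otimes> (s \<otimes> b)"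
      using that c by (simp add: r_distr r_minus a_minus_def)
    then show ?thesis
      using that c by (simp add: r_right_minus_eq)
  qed
  then show ?thesis
    unfolding frac_rel_def by auto
qed

lemma equiv_frac_rel: "equiv (carrier R \<times> S) (frac_rel R S)"
proof (rule equivI)
  show "frac_rel R S \<subseteq> (carrier R \<times> S) \<times> (carrier R \<times> S)"
    unfolding frac_rel_def by auto
  show "refl_on (carrier R \<times> S) (frac_rel R S)"
    by (rule refl_onI) (use S_one in \<open>auto simp: frac_rel_iff\<close>)
  show "sym (frac_rel R S)"
    by (rule symI) (clarsimp simp: frac_rel_iff, metis)
  show "trans (frac_rel R S)"
  proof (rule transI)
    fix x y z assume "(x, y) \<in> frac_rel R S" "(y, z) \<in> frac_rel R S"
    moreover obtain a s b t c r where xyz: "x = (a, s)" "y = (b, t)" "z = (c, r)"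
      by (metis surj_pair)
    ultimately obtain u v where
      h: "a \<in> carrier R" "s \<in> S" "b \<in> carrier R" "t \<in> S" "c \<in> carrier R" "r \<in> S" "u \<in> S" "v \<in> S"
      and e: "u \<otimes> (t \<otimes> a) = u \<otimes> (s \<otimes> b)" "v \<otimes> (r \<otimes> b) = v \<otimes> (t \<otimes> c)"
      by (auto simp: frac_rel_iff)
    note c = h S_carr[OF h(2)] S_carr[OF h(4)] S_carr[OF h(6)] S_carr[OF h(7)] S_carr[OF h(8)]
    have "(u \<otimes> v \<otimes> t) \<otimes> (r \<otimes> a) = (v \<otimes> r) \<otimes> (u \<otimes> (t \<otimes> a))"
      using c by (simp add: m_ac)
    also have "\<dots> = (u \<otimes> s) \<otimes> (v \<otimes> (r \<otimes> b))"
      unfolding e(1) using c by (simp add: m_ac)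
    also have "\<dots> = (u \<otimes> v \<otimes> t) \<otimes> (s \<otimes> c)"
      unfolding e(2) using c by (simp add: m_ac)
    finally show "(x, z) \<in> frac_rel R S"
      unfolding xyz frac_rel_iff using h S_mult by blast
  qed
qed

lemma fraction_eq_iff:
  assumes "a \<in> carrier R" "s \<in> S" "b \<in> carrier R" "t \<in> S"
  shows "fraction R S a s = fraction R S b t \<longleftrightarrow> (\<exists>u\<in>S. u \<otimes> (t \<otimes> a) = u \<otimes> (s \<otimes> b))"
  unfolding fraction_def using assms
  by (subst eq_equiv_class_iff[OF equiv_frac_rel]) (auto simp: frac_rel_iff)

lemma carrier_localization:
  "carrier (localization R S) = {fraction R S a s | a s. a \<in> carrier R \<and> s \<in> S}"
  by (auto simp: localization_def fraction_def quotient_def)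

lemma fraction_class_eqI:
  assumes "C \<noteq> {}" and "\<And>x. x \<in> C \<Longrightarrow> (x, y) \<in> frac_rel R S"
  shows "frac_rel R S `` C = frac_rel R S `` {y}"
  using assms equiv_frac_rel unfolding equiv_def sym_def trans_def by blast

lemma fraction_mult:
  assumes h: "a \<in> carrier R" "s \<in> S" "b \<in> carrier R" "t \<in> S"
  shows "fraction R S a s \<otimes>\<^bsub>localization R S\<^esub> fraction R S b t = fraction R S (a \<otimes> b) (s \<otimes> t)"
proof -
  have "frac_rel R S `` {(a' \<otimes> b', s' \<otimes> t') | a' s' b' t'.
      (a', s') \<in> fraction R S a s \<and> (b', t') \<in> fraction R S b t} = frac_rel R S `` {(a \<otimes> b, s \<otimes> t)}"
  proof (rule fraction_class_eqI)
    have "(a, s) \<in> fraction R S a s" "(b, t) \<in> fraction R S b t"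
      using h S_one by (auto simp: fraction_def frac_rel_iff)
    then show "{(a' \<otimes> b', s' \<otimes> t') | a' s' b' t'.
      (a', s') \<in> fraction R S a s \<and> (b', t') \<in> fraction R S b t} \<noteq> {}" by blast
  next
    fix x assume "x \<in> {(a' \<otimes> b', s' \<otimes> t') | a' s' b' t'.
      (a', s') \<in> fraction R S a s \<and> (b', t') \<in> fraction R S b t}"
    then obtain a' s' b' t' u v where x: "x = (a' \<otimes> b', s' \<otimes> t')"
      and k: "a' \<in> carrier R" "s' \<in> S" "b' \<in> carrier R" "t' \<in> S" "u \<in> S" "v \<in> S"
      and e: "u \<otimes> (s' \<otimes> a) = u \<otimes> (s \<otimes> a')" "v \<otimes> (t' \<otimes> b) = v \<otimes> (t \<otimes> b')"
      by (auto simp: fraction_def frac_rel_iff)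
    note c = h k S_carr[OF h(2)] S_carr[OF h(4)] S_carr[OF k(2)] S_carr[OF k(4)]
      S_carr[OF k(5)] S_carr[OF k(6)]
    have "(u \<otimes> v) \<otimes> ((s \<otimes> t) \<otimes> (a' \<otimes> b')) = (u \<otimes> (s \<otimes> a')) \<otimes> (v \<otimes> (t \<otimes> b'))"
      using c by (simp add: m_ac)
    also have "\<dots> = (u \<otimes> v) \<otimes> ((s' \<otimes> t') \<otimes> (a \<otimes> b))"
      unfolding e[symmetric] using c by (simp add: m_ac)
    finally show "(x, (a \<otimes> b, s \<otimes> t)) \<in> frac_rel R S"
      unfolding x frac_rel_iff using h k S_mult by blast
  qed
  then show ?thesis by (simp add: localization_def fraction_def)
qed

lemma fraction_add:
  assumes h: "a \<in> carrier R" "s \<in> S" "b \<in> carrier R" "t \<in> S"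
  shows "fraction R S a s \<oplus>\<^bsub>localization R S\<^esub> fraction R S b t
    = fraction R S (t \<otimes> a \<oplus> s \<otimes> b) (s \<otimes> t)"
proof -
  have "frac_rel R S `` {(t' \<otimes> a' \<oplus> s' \<otimes> b', s' \<otimes> t') | a' s' b' t'.
      (a', s') \<in> fraction R S a s \<and> (b', t') \<in> fraction R S b t}
    = frac_rel R S `` {(t \<otimes> a \<oplus> s \<otimes> b, s \<otimes> t)}"
  proof (rule fraction_class_eqI)
    have "(a, s) \<in> fraction R S a s" "(b, t) \<in> fraction R S b t"
      using h S_one by (auto simp: fraction_def frac_rel_iff)
    then show "{(t' \<otimes> a' \<oplus> s' \<otimes> b', s' \<otimes> t') | a' s' b' t'.
      (a', s') \<in> fraction R S a s \<and> (b', t') \<in> fraction R S b t} \<noteq> {}" by blast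
  next
    fix x assume "x \<in> {(t' \<otimes> a' \<oplus> s' \<otimes> b', s' \<otimes> t') | a' s' b' t'.
      (a', s') \<in> fraction R S a s \<and> (b', t') \<in> fraction R S b t}"
    then obtain a' s' b' t' u v where x: "x = (t' \<otimes> a' \<oplus> s' \<otimes> b', s' \<otimes> t')"
      and k: "a' \<in> carrier R" "s' \<in> S" "b' \<in> carrier R" "t' \<in> S" "u \<in> S" "v \<in> S"
      and e: "u \<otimes> (s' \<otimes> a) = u \<otimes> (s \<otimes> a')" "v \<otimes> (t' \<otimes> b) = v \<otimes> (t \<otimes> b')"
      by (auto simp: fraction_def frac_rel_iff)
    note c = h k S_carr[OF h(2)] S_carr[OF h(4)] S_carr[OF k(2)] S_carr[OF k(4)]
      S_carr[OF k(5)] S_carr[OF k(6)]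
    have "(u \<otimes> v) \<otimes> ((s \<otimes> t) \<otimes> (t' \<otimes> a' \<oplus> s' \<otimes> b'))
      = (v \<otimes> (t \<otimes> t')) \<otimes> (u \<otimes> (s \<otimes> a')) \<oplus> (u \<otimes> (s \<otimes> s')) \<otimes> (v \<otimes> (t \<otimes> b'))"
      using c by (simp add: m_ac r_distr)
    also have "\<dots> = (u \<otimes> v) \<otimes> ((s' \<otimes> t') \<otimes> (t \<otimes> a \<oplus> s \<otimes> b))"
      unfolding e[symmetric] using c by (simp add: m_ac r_distr)
    finally show "(x, (t \<otimes> a \<oplus> s \<otimes> b, s \<otimes> t)) \<in> frac_rel R S"
      unfolding x frac_rel_iff using h k c S_mult by blast
  qed
  then show ?thesis by (simp add: localization_def fraction_def)
qed

lemma fraction_eqI: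
  assumes "a \<in> carrier R" "s \<in> S" "b \<in> carrier R" "t \<in> S" "t \<otimes> a = s \<otimes> b"
  shows "fraction R S a s = fraction R S b t"
  using assms S_one by (auto simp: fraction_eq_iff)

lemma cring_localization: "cring (localization R S)"
proof -
  let ?L = "localization R S"
  have one: "\<one>\<^bsub>?L\<^esub> = fraction R S \<one> \<one>" and zero: "\<zero>\<^bsub>?L\<^esub> = fraction R S \<zero> \<one>"
    by (simp_all add: localization_def)
  have E: "\<And>x. x \<in> carrier ?L \<Longrightarrow> \<exists>a s. x = fraction R S a s \<and> a \<in> carrier R \<and> s \<in> S \<and> s \<in> carrier R"
    using S_carr by (auto simp: carrier_localization)
  have I: "\<And>a s. a \<in> carrier R \<Longrightarrow> s \<in> S \<Longrightarrow> fraction R S a s \<in> carrier ?L"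
    by (auto simp: carrier_localization)
  show ?thesis
  proof (rule cringI)
    show "abelian_group ?L"
    proof (rule abelian_groupI)
      fix x y z assume "x \<in> carrier ?L" "y \<in> carrier ?L" "z \<in> carrier ?L"
      then obtain a s b t c r where h:
        "x = fraction R S a s" "a \<in> carrier R" "s \<in> S" "s \<in> carrier R"
        "y = fraction R S b t" "b \<in> carrier R" "t \<in> S" "t \<in> carrier R"
        "z = fraction R S c r" "c \<in> carrier R" "r \<in> S" "r \<in> carrier R"
        using E by meson
      show "x \<oplus>\<^bsub>?L\<^esub> y \<oplus>\<^bsub>?L\<^esub> z = x \<oplus>\<^bsub>?L\<^esub> (y \<oplus>\<^bsub>?L\<^esub> z)"
        using h S_mult by (simp add: fraction_add) (rule fraction_eqI; simp add: r_distr a_ac m_ac)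
    next
      fix x y assume "x \<in> carrier ?L" "y \<in> carrier ?L"
      then obtain a s b t where h:
        "x = fraction R S a s" "a \<in> carrier R" "s \<in> S" "s \<in> carrier R"
        "y = fraction R S b t" "b \<in> carrier R" "t \<in> S" "t \<in> carrier R"
        using E by meson
      show "x \<oplus>\<^bsub>?L\<^esub> y \<in> carrier ?L"
        using h S_mult by (simp add: fraction_add I)
      show "x \<oplus>\<^bsub>?L\<^esub> y = y \<oplus>\<^bsub>?L\<^esub> x"
        using h S_mult by (simp add: fraction_add) (rule fraction_eqI; simp add: r_distr a_ac m_ac)
    next
      show "\<zero>\<^bsub>?L\<^esub> \<in> carrier ?L"
        unfolding zero using S_one by (simp add: I)
    next
      fix x assume "x \<in> carrier ?L"
      then obtain a s where h: "x = fraction R S a s" "a \<in> carrier R" "s \<in> S" "s \<in> carrier R"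
        using E by meson
      show "\<zero>\<^bsub>?L\<^esub> \<oplus>\<^bsub>?L\<^esub> x = x"
        unfolding zero using h S_one by (simp add: fraction_add)
      have "fraction R S (\<ominus> a) s \<oplus>\<^bsub>?L\<^esub> x = \<zero>\<^bsub>?L\<^esub>"
        unfolding zero using h S_one S_mult
        by (simp add: fraction_add) (rule fraction_eqI; simp add: r_minus l_neg)
      then show "\<exists>y\<in>carrier ?L. y \<oplus>\<^bsub>?L\<^esub> x = \<zero>\<^bsub>?L\<^esub>"
        using h I by (metis a_inv_closed)
    qed
  next
    show "comm_monoid ?L"
    proof (rule comm_monoidI)
      fix x y z assume "x \<in> carrier ?L" "y \<in> carrier ?L" "z \<in> carrier ?L"
      then obtain a s b t c r where h:
        "x = fraction R S a s" "a \<in> carrier R" "s \<in> S" "s \<in> carrier R"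
        "y = fraction R S b t" "b \<in> carrier R" "t \<in> S" "t \<in> carrier R"
        "z = fraction R S c r" "c \<in> carrier R" "r \<in> S" "r \<in> carrier R"
        using E by meson
      show "x \<otimes>\<^bsub>?L\<^esub> y \<otimes>\<^bsub>?L\<^esub> z = x \<otimes>\<^bsub>?L\<^esub> (y \<otimes>\<^bsub>?L\<^esub> z)"
        using h S_mult by (simp add: fraction_mult m_assoc)
    next
      fix x y assume "x \<in> carrier ?L" "y \<in> carrier ?L"
      then obtain a s b t where h:
        "x = fraction R S a s" "a \<in> carrier R" "s \<in> S" "s \<in> carrier R"
        "y = fraction R S b t" "b \<in> carrier R" "t \<in> S" "t \<in> carrier R"
        using E by meson
      show "x \<otimes>\<^bsub>?L\<^esub> y \<in> carrier ?L"
        using h S_mult by (simp add: fraction_mult I)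
      show "x \<otimes>\<^bsub>?L\<^esub> y = y \<otimes>\<^bsub>?L\<^esub> x"
        using h S_mult by (simp add: fraction_mult m_comm)
    next
      show "\<one>\<^bsub>?L\<^esub> \<in> carrier ?L"
        unfolding one using S_one by (simp add: I)
    next
      fix x assume "x \<in> carrier ?L"
      then obtain a s where h: "x = fraction R S a s" "a \<in> carrier R" "s \<in> S" "s \<in> carrier R"
        using E by meson
      show "\<one>\<^bsub>?L\<^esub> \<otimes>\<^bsub>?L\<^esub> x = x"
        unfolding one using h S_one by (simp add: fraction_mult)
    qed
  next
    fix x y z assume "x \<in> carrier ?L" "y \<in> carrier ?L" "z \<in> carrier ?L"
    then obtain a s b t c r where h:
      "x = fraction R S a s" "a \<in> carrier R" "s \<in> S" "s \<in> carrier R"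
      "y = fraction R S b t" "b \<in> carrier R" "t \<in> S" "t \<in> carrier R"
      "z = fraction R S c r" "c \<in> carrier R" "r \<in> S" "r \<in> carrier R"
      using E by meson
    show "(x \<oplus>\<^bsub>?L\<^esub> y) \<otimes>\<^bsub>?L\<^esub> z = x \<otimes>\<^bsub>?L\<^esub> z \<oplus>\<^bsub>?L\<^esub> y \<otimes>\<^bsub>?L\<^esub> z"
      using h S_mult
      by (simp add: fraction_add fraction_mult) (rule fraction_eqI; simp add: l_distr r_distr m_ac)
  qed
qed

end


subsection \<open>Regular local rings\<close>

definition krull_dim :: "('a, 'm) ring_scheme \<Rightarrow> enat" where
  "krull_dim R = (SUP k \<in> {k :: nat. \<exists>P :: nat \<Rightarrow> 'a set.
     (\<forall>i\<le>k. primeideal (P i) R) \<and> (\<forall>i<k. P i \<subset> P (Suc i))}. enat k)"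

text \<open>The minimal number of generators of an ideal; it is \<open>\<infinity>\<close> if there is no finite generating set.\<close>

definition min_gens :: "('a, 'm) ring_scheme \<Rightarrow> 'a set \<Rightarrow> enat" where
  "min_gens R I = (INF A \<in> {A. finite A \<and> A \<subseteq> carrier R \<and> Idl\<^bsub>R\<^esub> A = I}. enat (card A))"

definition local_ring :: "('a, 'm) ring_scheme \<Rightarrow> bool" where
  "local_ring R \<longleftrightarrow> cring R \<and> (\<exists>!M. maximalideal M R)"

definition regular_local_ring :: "('a, 'm) ring_scheme \<Rightarrow> bool" where
  "regular_local_ring R \<longleftrightarrow> local_ring R \<and> noetherian_ring R \<and>
     (\<forall>M. maximalideal M R \<longrightarrow> min_gens R M = krull_dim R)"


section \<open>Hypersurfaces in affine space\<close>

text \<open>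
  Polynomials over the complex numbers whose variables are indexed by a finite type \<open>'s\<close>, so that
  the number of variables is \<open>CARD('s)\<close>; a polynomial maps exponent vectors to coefficients.
\<close>

type_synonym 's cpoly = "('s \<Rightarrow>\<^sub>0 nat) \<Rightarrow>\<^sub>0 complex"

abbreviation poly_const :: "complex \<Rightarrow> 's cpoly" where
  "poly_const c \<equiv> Poly_Mapping.single 0 c"

definition poly_eval :: "'s::finite cpoly \<Rightarrow> complex ^ 's \<Rightarrow> complex" where
  "poly_eval f p = (\<Sum>m \<in> Poly_Mapping.keys f. Poly_Mapping.lookup f m *
     (\<Prod>i\<in>UNIV. (p $ i) ^ Poly_Mapping.lookup m i))"

definition zero_locus :: "'s::finite cpoly \<Rightarrow> (complex ^ 's) set" where
  "zero_locus F = {p. poly_eval F p = 0}"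

abbreviation poly_ring :: "'s cpoly ring" where
  "poly_ring \<equiv> ring_of_type_algebra"

text \<open>The ideal \<open>\<langle>F\<rangle>\<close> need not be radical: the quotient below is in general not reduced.\<close>

definition coord_ring :: "'s cpoly \<Rightarrow> 's cpoly set ring" where
  "coord_ring F = poly_ring Quot (Idl\<^bsub>poly_ring\<^esub> {F})"

definition residue_class :: "'s cpoly \<Rightarrow> 's cpoly \<Rightarrow> 's cpoly set" where
  "residue_class F f = (Idl\<^bsub>poly_ring\<^esub> {F}) +>\<^bsub>poly_ring\<^esub> f"

definition point_ideal :: "'s::finite cpoly \<Rightarrow> complex ^ 's \<Rightarrow> 's cpoly set set" where
  "point_ideal F p = residue_class F ` {f. poly_eval f p = 0}"

definition point_compl :: "'s::finite cpoly \<Rightarrow> complex ^ 's \<Rightarrow> 's cpoly set set" where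
  "point_compl F p = carrier (coord_ring F) - point_ideal F p"

type_synonym 's germ = "('s cpoly set \<times> 's cpoly set) set"

definition local_ring_at :: "'s::finite cpoly \<Rightarrow> complex ^ 's \<Rightarrow> 's germ ring" where
  "local_ring_at F p = localization (coord_ring F) (point_compl F p)"

definition max_ideal_at :: "'s::finite cpoly \<Rightarrow> complex ^ 's \<Rightarrow> 's germ set" where
  "max_ideal_at F p =
     {fraction (coord_ring F) (point_compl F p) a s | a s. a \<in> point_ideal F p \<and> s \<in> point_compl F p}"

definition nonsingular_point :: "'s::finite cpoly \<Rightarrow> complex ^ 's \<Rightarrow> bool" where
  "nonsingular_point F p \<longleftrightarrow> regular_local_ring (local_ring_at F p)"

definition const_germ :: "'s::finite cpoly \<Rightarrow> complex ^ 's \<Rightarrow> complex \<Rightarrow> 's germ" where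
  "const_germ F p c = fraction (coord_ring F) (point_compl F p)
     (residue_class F (poly_const c)) \<one>\<^bsub>coord_ring F\<^esub>"

definition max_ideal_pow :: "'s::finite cpoly \<Rightarrow> complex ^ 's \<Rightarrow> nat \<Rightarrow> 's germ set" where
  "max_ideal_pow F p k = max_ideal_at F p [^]\<^bsub>ideals_set (local_ring_at F p)\<^esub> k"

text \<open>
  The quotient of the maximal ideal by its \<open>k\<close>-th power (\<open>k \<ge> 1\<close>) has complex dimension \<open>d\<close>.
  It is regarded as a subspace of the quotient of the local ring by that power, which is an algebra
  over the image of the constants.  Since \<^const>\<open>ring.dimension\<close> is a relation that only holds for
  finite-dimensional spaces, no default value for infinite dimension is involved.
\<close>

definition max_ideal_quotient_dim :: "'s::finite cpoly \<Rightarrow> complex ^ 's \<Rightarrow> nat \<Rightarrow> nat \<Rightarrow> bool" where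
  "max_ideal_quotient_dim F p k d \<longleftrightarrow>
     (let A = local_ring_at F p; J = max_ideal_pow F p k
      in ring.dimension (A Quot J) d
           ((\<lambda>c. J +>\<^bsub>A\<^esub> const_germ F p c) ` UNIV)
           ((\<lambda>x. J +>\<^bsub>A\<^esub> x) ` max_ideal_at F p))"

end

theory Submission
  imports Defs
begin

text \<open>
  Translate \<open>p\<close> to the origin, so that \<open>F\<close> becomes a polynomial \<open>G \<noteq> 0\<close> without constant term, and
  let \<open>\<alpha>\<close> be the smallest monomial of \<open>G\<close> for a fixed graded monomial order.  Write \<open>s\<close> for the
  number of variables, \<open>M\<close> for the ideal of the origin in the polynomial ring, and \<open>\<mm>\<close> for the
  maximal ideal of the local ring.  Both sides of the equivalence say that \<open>\<alpha>\<close> has degree 1, that is,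
  that \<open>G\<close> has a non-zero linear part.

  \<^emph>\<open>The dimension.\<close>  Polynomials with non-zero constant term are invertible modulo powers of \<open>M\<close>,
  so the local ring modulo \<open>\<mm> ^ k\<close> is the polynomial ring modulo \<open>(G) + M ^ k\<close>.  As in the theory of
  standard bases, the monomials of degree less than \<open>k\<close> that are not divisible by \<open>\<alpha>\<close> form a
  basis of this quotient (\<open>standard_span\<close>, \<open>standard_independent\<close>).  If \<open>\<alpha>\<close> is a variable, there are
  \<open>(n + s - 1) choose (s - 1)\<close> of them for \<open>k = n + 1\<close>, and the constant monomial has to be left out for
  \<open>\<mm>\<close> itself.  If \<open>\<alpha>\<close> has degree at least 2, then all monomials that avoid one fixed variable of \<open>\<alpha>\<close>
  are still present, together with that variable, so the dimension is strictly larger.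

  \<^emph>\<open>Regularity.\<close>  The minimal number of generators of \<open>\<mm>\<close> is bounded below by the dimension of \<open>\<mm>\<close>
  modulo its square (\<open>min_gens_ge\<close>), which is \<open>s\<close> if \<open>\<alpha>\<close> has degree at least 2 and \<open>s - 1\<close> otherwise; in the
  second case the variables other than \<open>\<alpha>\<close> generate (\<open>min_gens_le\<close>).  The Krull dimension is at most
  \<open>s - 1\<close> (\<open>krull_dim_le\<close>): a chain of primes in the local ring contracts to a chain of non-zero primes
  of the polynomial ring, and prolonged by the zero ideal it has length at most \<open>s\<close>, since elements
  chosen along a chain behave like algebraically independent ones while \<open>s + 1\<close> polynomials in \<open>s\<close>
  variables are always dependent (\<open>poly_prime_chain_length\<close>).  If \<open>\<alpha>\<close> is a variable, a chain of length
  \<open>s - 1\<close> is obtained by adjoining the other variables one after the other (\<open>krull_dim_ge\<close>).  The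
  ideals in it are prime because their quotients embed into power series rings; this is expressed with
  standard monomials to every finite order (\<open>poly_prime_local_prime\<close>).  Finally, the local ring is
  Noetherian by Dickson's lemma and division (\<open>poly_ideal_finite_basis\<close>).
\<close>

section \<open>Monomials and their order\<close>

abbreviation coef :: "'s cpoly \<Rightarrow> ('s \<Rightarrow>\<^sub>0 nat) \<Rightarrow> complex" where
  "coef \<equiv> Poly_Mapping.lookup"

abbreviation supp :: "'s cpoly \<Rightarrow> ('s \<Rightarrow>\<^sub>0 nat) set" where
  "supp \<equiv> Poly_Mapping.keys"

abbreviation expon :: "('s \<Rightarrow>\<^sub>0 nat) \<Rightarrow> 's \<Rightarrow> nat" where
  "expon \<equiv> Poly_Mapping.lookup"

abbreviation unit_expon :: "'s \<Rightarrow> ('s \<Rightarrow>\<^sub>0 nat)" where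
  "unit_expon i \<equiv> Poly_Mapping.single i (Suc 0)"

abbreviation mon :: "('s \<Rightarrow>\<^sub>0 nat) \<Rightarrow> 's cpoly" where
  "mon m \<equiv> Poly_Mapping.single m 1"

abbreviation pvar :: "'s \<Rightarrow> 's cpoly" where
  "pvar i \<equiv> mon (unit_expon i)"

definition tdeg :: "('s::finite \<Rightarrow>\<^sub>0 nat) \<Rightarrow> nat" where
  "tdeg m = (\<Sum>i\<in>UNIV. expon m i)"

lemma tdeg_add [simp]: "tdeg (m + m') = tdeg m + tdeg m'"
  by (simp add: tdeg_def lookup_add sum.distrib)

lemma tdeg_zero [simp]: "tdeg 0 = 0"
  by (simp add: tdeg_def)

lemma tdeg_eq_0_iff [simp]: "tdeg m = 0 \<longleftrightarrow> m = 0"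
  by (auto simp: tdeg_def intro: poly_mapping_eqI)

lemma tdeg_pos_iff [simp]: "0 < tdeg m \<longleftrightarrow> m \<noteq> 0"
  using tdeg_eq_0_iff[of m] by linarith

lemma expon_le_deg: "expon m i \<le> tdeg m"
  unfolding tdeg_def by (rule member_le_sum) auto

lemma tdeg_unit_expon [simp]: "tdeg (unit_expon i) = 1"
proof -
  have "tdeg (unit_expon i) = (\<Sum>j\<in>UNIV. if j = i then 1 else 0)"
    unfolding tdeg_def by (rule sum.cong) (auto simp: lookup_single when_def)
  then show ?thesis by simp
qed

text \<open>
  Subtraction of exponent vectors truncates at 0, so \<open>m - d\<close> is the exponent of a quotient only if
  \<open>d\<close> divides \<open>m\<close>.
\<close>

lemma expon_le_imp_add:
  assumes "\<And>i. expon d i \<le> expon m i"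
  shows "m = (m - d) + d"
  by (rule poly_mapping_eqI) (simp add: lookup_add lookup_minus assms)

lemma ex_expon_pos: "m \<noteq> 0 \<Longrightarrow> \<exists>i. 0 < expon m i"
  by (metis gr0I poly_mapping_eqI lookup_zero)

lemma divide_var: "0 < expon m i \<Longrightarrow> m = (m - unit_expon i) + unit_expon i"
  by (rule expon_le_imp_add) (auto simp: lookup_single when_def)

lemma coef_pvar_0: "coef (pvar (i :: 's::finite)) 0 = 0"
  by (metis tdeg_unit_expon tdeg_zero lookup_single_not_eq zero_neq_one)

lemma tdeg_eq_1E:
  assumes "tdeg m = 1" obtains j where "m = unit_expon j"
proof -
  have "m \<noteq> 0" using assms by auto
  then obtain j where j: "0 < expon m j" using ex_expon_pos by blast
  then have "m = (m - unit_expon j) + unit_expon j" by (rule divide_var)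
  then have "tdeg m = tdeg (m - unit_expon j) + 1"
    by (metis tdeg_add tdeg_unit_expon)
  with assms have "m - unit_expon j = 0" by simp
  with \<open>m = _ + _\<close> have "m = unit_expon j" by (metis add_0)
  then show thesis by (rule that)
qed

lemma finite_deg_le: "finite {m :: 's::finite \<Rightarrow>\<^sub>0 nat. tdeg m \<le> N}"
proof (rule finite_imageD)
  have "Poly_Mapping.lookup ` {m :: 's \<Rightarrow>\<^sub>0 nat. tdeg m \<le> N} \<subseteq> (\<Pi>\<^sub>E i\<in>UNIV. {..N})"
    by (auto intro: order_trans[OF expon_le_deg])
  then show "finite (Poly_Mapping.lookup ` {m :: 's \<Rightarrow>\<^sub>0 nat. tdeg m \<le> N})"
    by (rule finite_subset) (simp add: finite_PiE)
  show "inj_on Poly_Mapping.lookup {m :: 's \<Rightarrow>\<^sub>0 nat. tdeg m \<le> N}"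
    by (rule inj_onI) (simp add: poly_mapping_eqI)
qed

text \<open>
  The index type carries no order; any fixed numbering of the variables will do.
\<close>

definition var_index :: "'s::finite \<Rightarrow> nat" where
  "var_index = (SOME e. inj e)"

lemma inj_var_index: "inj (var_index :: 's::finite \<Rightarrow> nat)"
proof -
  have "\<exists>e :: 's \<Rightarrow> nat. inj e"
    using finite_imp_inj_to_nat_seg[of "UNIV :: 's set"] by auto
  then show ?thesis unfolding var_index_def by (rule someI_ex)
qed

text \<open>
  The monomial order is pulled back along this embedding into finitely supported sequences with
  their lexicographic order.  The embedding is additive, which makes the order compatible with
  multiplication; the total degree is the first entry, which makes it graded, so that only finitely
  many monomials lie below a given one.
\<close>

definition mono_key :: "('s::finite \<Rightarrow>\<^sub>0 nat) \<Rightarrow> (nat \<Rightarrow>\<^sub>0 nat)" where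
  "mono_key m = Poly_Mapping.single 0 (tdeg m) +
     (\<Sum>i\<in>UNIV. Poly_Mapping.single (Suc (var_index i)) (expon m i))"

lemma mono_key_add: "mono_key (m + m') = mono_key m + mono_key m'"
  by (simp add: mono_key_def lookup_add single_add sum.distrib algebra_simps)

lemma lookup_mono_key_0: "Poly_Mapping.lookup (mono_key m) 0 = tdeg m"
  by (simp add: mono_key_def lookup_add lookup_sum lookup_single)

lemma lookup_mono_key_Suc: "Poly_Mapping.lookup (mono_key m) (Suc (var_index i)) = expon m i"
proof -
  have "Poly_Mapping.lookup (mono_key m) (Suc (var_index i)) =
      (\<Sum>j\<in>UNIV. if j = i then expon m j else 0)"
    unfolding mono_key_def lookup_add lookup_sum lookup_single
    by (auto simp: when_def inj_eq[OF inj_var_index] intro!: sum.cong)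
  then show ?thesis by simp
qed

lemma inj_mono_key: "inj (mono_key :: ('s::finite \<Rightarrow>\<^sub>0 nat) \<Rightarrow> _)"
proof (rule injI, rule poly_mapping_eqI)
  fix m m' :: "'s \<Rightarrow>\<^sub>0 nat" and i :: 's
  assume "mono_key m = mono_key m'"
  then have "Poly_Mapping.lookup (mono_key m) (Suc (var_index i)) =
      Poly_Mapping.lookup (mono_key m') (Suc (var_index i))" by simp
  then show "expon m i = expon m' i" unfolding lookup_mono_key_Suc .
qed

lemma mono_key_eq_iff [simp]: "mono_key m = mono_key m' \<longleftrightarrow> m = m'"
  using inj_mono_key by (rule inj_eq)

lemma mono_key_less_if_deg_less: "tdeg m < tdeg m' \<Longrightarrow> mono_key m < mono_key m'"
  unfolding less_poly_mapping.rep_eq less_fun_def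
  by (rule exI[of _ 0]) (simp add: lookup_mono_key_0)

lemma tdeg_le_if_mono_key_le: "mono_key m \<le> mono_key m' \<Longrightarrow> tdeg m \<le> tdeg m'"
  using mono_key_less_if_deg_less leD not_le by blast

lemma finite_mono_key_less: "finite {m'. mono_key m' < mono_key (m :: 's::finite \<Rightarrow>\<^sub>0 nat)}"
  by (rule finite_subset[OF _ finite_deg_le[of "tdeg m"]])
    (auto intro: tdeg_le_if_mono_key_le less_imp_le)

definition initial :: "'s::finite cpoly \<Rightarrow> ('s \<Rightarrow>\<^sub>0 nat) \<Rightarrow> bool" where
  "initial f m \<longleftrightarrow> m \<in> supp f \<and> (\<forall>m'\<in>supp f. mono_key m \<le> mono_key m')"

definition leading :: "'s::finite cpoly \<Rightarrow> ('s \<Rightarrow>\<^sub>0 nat) \<Rightarrow> bool" where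
  "leading f m \<longleftrightarrow> m \<in> supp f \<and> (\<forall>m'\<in>supp f. mono_key m' \<le> mono_key m)"

lemma ex_initial: assumes "f \<noteq> 0" obtains m where "initial f m"
proof -
  have "supp f \<noteq> {}" using assms by simp
  then obtain m where "m \<in> supp f" "\<forall>m'\<in>supp f. mono_key m \<le> mono_key m'"
    using ex_min_if_finite[of "mono_key ` supp f"] by (auto simp: not_less)
  then show thesis using that by (auto simp: initial_def)
qed

lemma ex_leading: assumes "f \<noteq> 0" obtains m where "leading f m"
proof -
  have "supp f \<noteq> {}" using assms by simp
  then have "Max (mono_key ` supp f) \<in> mono_key ` supp f" by (intro Max_in) auto
  then obtain m where "m \<in> supp f" "Max (mono_key ` supp f) = mono_key m" by auto
  then have "leading f m" unfolding leading_def
    by (metis Max_ge finite_imageI finite_keys imageI)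
  then show thesis using that by blast
qed

subsection \<open>Products of polynomials\<close>

lemma cpoly_sum_monos: "f = (\<Sum>m\<in>supp f. Poly_Mapping.single m (coef f m))"
proof (rule poly_mapping_eqI)
  fix k
  have "coef (\<Sum>m\<in>supp f. Poly_Mapping.single m (coef f m)) k =
      (\<Sum>m\<in>supp f. if m = k then coef f m else 0)"
    unfolding lookup_sum by (rule sum.cong) (auto simp: lookup_single when_def)
  also have "\<dots> = coef f k"
    by (auto simp: in_keys_iff)
  finally show "coef f k = coef (\<Sum>m\<in>supp f. Poly_Mapping.single m (coef f m)) k" ..
qed

lemma cpoly_induct [case_names zero add single]:
  assumes "P 0" "\<And>f g. P f \<Longrightarrow> P g \<Longrightarrow> P (f + g)" "\<And>m c. P (Poly_Mapping.single m c)"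
  shows "P (f :: 's cpoly)"
proof -
  have "P (\<Sum>m\<in>A. Poly_Mapping.single m (coef f m))" if "finite A" for A
    using that by (induct A) (auto intro: assms)
  from this[OF finite_keys] have "P (\<Sum>m\<in>supp f. Poly_Mapping.single m (coef f m))" .
  then show ?thesis by (simp flip: cpoly_sum_monos)
qed

lemma coef_mult:
  "coef (f * g) k = (\<Sum>a\<in>supp f. \<Sum>b\<in>supp g. if a + b = k then coef f a * coef g b else 0)"
proof -
  have "f * g = (\<Sum>a\<in>supp f. Poly_Mapping.single a (coef f a)) *
      (\<Sum>b\<in>supp g. Poly_Mapping.single b (coef g b))"
    by (simp flip: cpoly_sum_monos)
  also have "\<dots> = (\<Sum>a\<in>supp f. \<Sum>b\<in>supp g. Poly_Mapping.single (a + b) (coef f a * coef g b))"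
    by (simp add: sum_product mult_single)
  finally show ?thesis
    by (simp add: lookup_sum lookup_single when_def)
qed

text \<open>
  Products have no cancellation at an exponent that arises from only one pair of exponents, such
  as the smallest or the largest one.
\<close>

lemma coef_mult_unique:
  assumes "\<And>a' b'. a' \<in> supp f \<Longrightarrow> b' \<in> supp g \<Longrightarrow> a' + b' = a + b \<Longrightarrow> a' = a \<and> b' = b"
  shows "coef (f * g) (a + b) = coef f a * coef g b"
proof -
  have "coef (f * g) (a + b) = (\<Sum>a'\<in>supp f. \<Sum>b'\<in>supp g.
      if b' = b then if a' = a then coef f a * coef g b else 0 else 0)"
    unfolding coef_mult using assms by (intro sum.cong refl) auto
  also have "\<dots> = (\<Sum>a'\<in>supp f. if a' = a then coef f a * coef g b else 0)"
    by (intro sum.cong refl) (auto simp: in_keys_iff)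
  also have "\<dots> = coef f a * coef g b"
    by (auto simp: in_keys_iff)
  finally show ?thesis .
qed

lemma coef_mult_0: "coef (f * g) 0 = coef f 0 * coef g (0 :: 's::finite \<Rightarrow>\<^sub>0 nat)"
proof -
  have "coef (f * g) (0 + 0) = coef f 0 * coef g 0"
  proof (rule coef_mult_unique)
    fix a' b' :: "'s \<Rightarrow>\<^sub>0 nat" assume "a' + b' = 0 + 0"
    then have "tdeg a' + tdeg b' = 0" by (metis add_0 tdeg_add tdeg_zero)
    then show "a' = 0 \<and> b' = 0" by simp
  qed
  then show ?thesis by simp
qed

lemma coef_const_mult: "coef (poly_const c * f) k = c * coef f k"
proof (cases "c = 0")
  case False
  have "coef (poly_const c * f) k = (\<Sum>a\<in>supp (poly_const c). \<Sum>b\<in>supp f.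
      if a + b = k then coef (poly_const c) a * coef f b else 0)"
    by (rule coef_mult)
  also have "\<dots> = (\<Sum>b\<in>supp f. if b = k then c * coef f b else 0)"
    using False by simp
  also have "\<dots> = c * coef f k"
    by (simp add: in_keys_iff)
  finally show ?thesis .
qed simp

lemma coef_mono_mult: "coef (mon d * f) (d + m) = coef f m"
proof -
  have "coef (mon d * f) (d + m) = coef (mon d) d * coef f m"
    by (rule coef_mult_unique) auto
  then show ?thesis by simp
qed

lemma supp_mult: "k \<in> supp (f * g) \<Longrightarrow> \<exists>a\<in>supp f. \<exists>b\<in>supp g. k = a + b"
  using keys_mult by fastforce

lemma initial_mult:
  assumes "initial f a" "initial g b"
  shows "initial (f * g) (a + b)"
proof -
  have le: "mono_key (a + b) \<le> mono_key (a' + b')"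
    if "a' \<in> supp f" "b' \<in> supp g" for a' b'
    using assms that unfolding mono_key_add initial_def by (simp add: add_mono)
  have "coef (f * g) (a + b) = coef f a * coef g b"
  proof (rule coef_mult_unique)
    fix a' b' assume h: "a' \<in> supp f" "b' \<in> supp g" "a' + b' = a + b"
    then have "mono_key a \<le> mono_key a'" "mono_key b \<le> mono_key b'"
      using assms by (auto simp: initial_def)
    moreover have "mono_key a' + mono_key b' = mono_key a + mono_key b"
      using h(3) by (metis mono_key_add)
    ultimately have "mono_key a' = mono_key a"
      by (metis add_le_cancel_left add_le_imp_le_right add_mono antisym order_refl)
    then show "a' = a \<and> b' = b" using h(3) by auto
  qed
  then have "a + b \<in> supp (f * g)"
    using assms by (auto simp: initial_def in_keys_iff)
  with le show ?thesis unfolding initial_def by (metis supp_mult)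
qed

lemma leading_mono_mult:
  assumes "leading f m"
  shows "leading (mon d * f) (d + m)"
  unfolding leading_def
proof (intro conjI ballI)
  show "d + m \<in> supp (mon d * f)"
    using assms by (simp add: in_keys_iff coef_mono_mult leading_def)
  fix k assume "k \<in> supp (mon d * f)"
  then obtain b where "b \<in> supp f" "k = d + b" using supp_mult by fastforce
  then show "mono_key k \<le> mono_key (d + m)"
    using assms by (simp add: leading_def mono_key_add)
qed

subsection \<open>Substitution\<close>

text \<open>
  One evaluation map serves two purposes: with complex values it is the value at a point, with
  polynomial values it is a change of coordinates.
\<close>

definition subst :: "(complex \<Rightarrow> 'a::comm_ring_1) \<Rightarrow> ('s::finite \<Rightarrow> 'a) \<Rightarrow> 's cpoly \<Rightarrow> 'a" where
  "subst c \<sigma> f = (\<Sum>m\<in>supp f. c (coef f m) * (\<Prod>i\<in>UNIV. \<sigma> i ^ expon m i))"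

locale coeff_hom =
  fixes c :: "complex \<Rightarrow> 'a::comm_ring_1"
  assumes c_add: "c (x + y) = c x + c y"
    and c_mult: "c (x * y) = c x * c y"
    and c_1: "c 1 = 1"
begin

lemma c_0: "c 0 = 0"
  using c_add[of 0 0] by simp

lemma subst_single: "subst c \<sigma> (Poly_Mapping.single m a) = c a * (\<Prod>i\<in>UNIV. \<sigma> i ^ expon m i)"
  by (cases "a = 0") (simp_all add: subst_def c_0)

lemma subst_add: "subst c \<sigma> (f + g) = subst c \<sigma> f + subst c \<sigma> g"
  unfolding subst_def
  by (rule setsum_keys_plus_distrib) (simp_all add: c_0 c_add algebra_simps)

lemma subst_0: "subst c \<sigma> 0 = 0"
  by (simp add: subst_def)

lemma subst_mult: "subst c \<sigma> (f * g) = subst c \<sigma> f * subst c \<sigma> g"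
proof (induct f rule: cpoly_induct)
  case (single m a)
  show ?case
  proof (induct g rule: cpoly_induct)
    case (single m' b)
    show ?case
      by (simp add: mult_single subst_single c_mult lookup_add power_add prod.distrib)
  qed (simp_all add: subst_0 subst_add algebra_simps)
qed (simp_all add: subst_0 subst_add algebra_simps)

lemma subst_const: "subst c \<sigma> (poly_const a) = c a"
  by (simp add: subst_single)

lemma subst_1: "subst c \<sigma> 1 = 1"
  using subst_const[of \<sigma> 1] by (simp add: c_1)

lemma subst_var: "subst c \<sigma> (pvar i) = \<sigma> i"
proof -
  have "(\<Prod>j\<in>UNIV. \<sigma> j ^ expon (unit_expon i) j) = (\<Prod>j\<in>UNIV. if j = i then \<sigma> i else 1)"
    by (rule prod.cong) (auto simp: lookup_single when_def)
  then show ?thesis by (simp add: subst_single c_1)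
qed

end

lemma mon_power: "mon m ^ k = mon (\<Sum>j<k. m)"
  by (induct k) (simp_all add: mult_single add.commute)

lemma mon_sum: "finite A \<Longrightarrow> (\<Prod>i\<in>A. mon (e i)) = mon (\<Sum>i\<in>A. e i)"
  by (induct A rule: finite_induct) (simp_all add: mult_single)

lemma mon_eq_prod_vars: "mon m = (\<Prod>i\<in>UNIV. pvar (i :: 's::finite) ^ expon m i)"
proof -
  have "(\<Sum>i\<in>UNIV. \<Sum>j<expon m i. unit_expon i) = m"
  proof (rule poly_mapping_eqI)
    fix k
    have "expon (\<Sum>i\<in>UNIV. \<Sum>j<expon m i. unit_expon i) k = (\<Sum>i\<in>UNIV. if i = k then expon m i else 0)"
      unfolding lookup_sum by (rule sum.cong) (auto simp: lookup_single when_def)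
    then show "expon (\<Sum>i\<in>UNIV. \<Sum>j<expon m i. unit_expon i) k = expon m k" by simp
  qed
  then show ?thesis by (simp add: mon_power mon_sum)
qed

text \<open>
  A ring homomorphism is determined by its values on constants and variables.  Identities between
  compositions of translations and evaluations are reduced to these cases.
\<close>

lemma cpoly_hom_eqI:
  fixes h h' :: "'s::finite cpoly \<Rightarrow> 'a::comm_ring_1"
  assumes "\<And>f g. h (f + g) = h f + h g" "\<And>f g. h' (f + g) = h' f + h' g"
    and mult: "\<And>f g. h (f * g) = h f * h g" "\<And>f g. h' (f * g) = h' f * h' g"
    and const: "\<And>a. h (poly_const a) = h' (poly_const a)" and pvar: "\<And>i. h (pvar i) = h' (pvar i)"
    and one: "h 1 = 1" "h' 1 = 1"
  shows "h f = h' f"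
proof (induct f rule: cpoly_induct)
  case zero
  show ?case using const[of 0] by simp
next
  case (single m a)
  have pow: "h (f ^ k) = h f ^ k" "h' (f ^ k) = h' f ^ k" for f k
    by (induct k) (simp_all add: one mult)
  have prod: "h (\<Prod>i\<in>A. F i) = (\<Prod>i\<in>A. h (F i))" "h' (\<Prod>i\<in>A. F i) = (\<Prod>i\<in>A. h' (F i))"
    if "finite A" for A :: "'s set" and F
    using that by (induct A) (simp_all add: one mult)
  have "Poly_Mapping.single m a = poly_const a * (\<Prod>i\<in>UNIV. pvar i ^ expon m i)"
    unfolding mon_eq_prod_vars[symmetric] by (simp add: mult_single)
  then show ?case by (simp add: mult prod pow const pvar)
qed (simp_all add: assms)

interpretation eval_hom: coeff_hom "\<lambda>x. x :: complex"
  by unfold_locales auto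

interpretation const_hom: coeff_hom "poly_const :: complex \<Rightarrow> 's::finite cpoly"
  by unfold_locales (auto simp: single_add mult_single)

lemma poly_eval_subst: "poly_eval f p = subst (\<lambda>x. x) (($) p) f"
  by (simp add: poly_eval_def subst_def)

lemma poly_eval_add: "poly_eval (f + g) p = poly_eval f p + poly_eval g p"
  and poly_eval_mult: "poly_eval (f * g) p = poly_eval f p * poly_eval g p"
  and poly_eval_const: "poly_eval (poly_const a) p = a"
  and poly_eval_1: "poly_eval 1 p = 1"
  unfolding poly_eval_subst
  by (simp_all add: eval_hom.subst_add eval_hom.subst_mult eval_hom.subst_const
      eval_hom.subst_1)

lemma poly_eval_var: "poly_eval (pvar i) p = p $ i"
  unfolding poly_eval_subst by (rule eval_hom.subst_var)

definition translate :: "complex ^ 's \<Rightarrow> 's::finite cpoly \<Rightarrow> 's cpoly" where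
  "translate q = subst poly_const (\<lambda>i. pvar i + poly_const (q $ i))"

lemma translate_add: "translate q (f + g) = translate q f + translate q g"
  and translate_mult: "translate q (f * g) = translate q f * translate q g"
  and translate_const: "translate q (poly_const a) = poly_const a"
  and translate_1: "translate q 1 = 1"
  and translate_var: "translate q (pvar i) = pvar i + poly_const (q $ i)"
  unfolding translate_def
  by (simp_all add: const_hom.subst_add const_hom.subst_mult const_hom.subst_const
      const_hom.subst_1 const_hom.subst_var)

lemma translate_translate: "translate q (translate (- q) f) = f"
  by (rule cpoly_hom_eqI[where h = "\<lambda>f. translate q (translate (- q) f)" and h' = "\<lambda>f. f"])
    (simp_all add: translate_add translate_mult translate_const translate_1 translate_var
      add.assoc flip: single_add)

lemma poly_eval_translate: "poly_eval (translate q f) 0 = poly_eval f q"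
  by (rule cpoly_hom_eqI[where h = "\<lambda>f. poly_eval (translate q f) 0" and h' = "\<lambda>f. poly_eval f q"])
    (simp_all add: translate_add translate_mult translate_const translate_1 translate_var
      poly_eval_add poly_eval_mult poly_eval_const poly_eval_1 poly_eval_var)

lemma poly_eval_origin: "poly_eval f 0 = coef f 0"
proof (rule cpoly_hom_eqI[where h = "\<lambda>f. poly_eval f 0" and h' = "\<lambda>f. coef f 0"])
  show "poly_eval (pvar i) 0 = coef (pvar i) 0" for i :: 'a
    by (simp add: poly_eval_var coef_pvar_0)
qed (simp_all add: poly_eval_add poly_eval_mult poly_eval_const poly_eval_1 lookup_add coef_mult_0)

section \<open>Standard monomials of a hypersurface\<close>

text \<open>
  The monomials to be neglected when one works to order \<open>N\<close> on the coordinate subspace on which the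
  variables in \<open>Y\<close> vanish.
\<close>

definition tail :: "'s set \<Rightarrow> nat \<Rightarrow> ('s::finite \<Rightarrow>\<^sub>0 nat) set" where
  "tail Y N = {m. N \<le> tdeg m \<or> (\<exists>v\<in>Y. 0 < expon m v)}"

lemma tail_add: "m' \<in> tail Y N \<Longrightarrow> m + m' \<in> tail Y N"
  by (auto simp: tail_def lookup_add)

text \<open>
  For \<open>Y = {}\<close> this is \<open>(G)\<close> plus a power of the ideal of the origin, as needed for the dimension
  count; for growing \<open>Y\<close> and all \<open>N\<close> it yields a chain of primes.  As both sets of extra generators
  consist of monomials, one normal form theorem covers both uses.
\<close>

definition trunc_ideal :: "'s::finite cpoly \<Rightarrow> 's set \<Rightarrow> nat \<Rightarrow> 's cpoly set" where
  "trunc_ideal G Y N = {a * G + b | a b. supp b \<subseteq> tail Y N}"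

lemma supp_mult_tail: "supp b \<subseteq> tail Y N \<Longrightarrow> supp (f * b) \<subseteq> tail Y N"
  by (auto dest!: supp_mult intro: tail_add)

lemma supp_add_subset: "supp f \<subseteq> A \<Longrightarrow> supp g \<subseteq> A \<Longrightarrow> supp (f + g) \<subseteq> A"
  using keys_add[of f g] by blast

lemma supp_diff_subset: "supp f \<subseteq> A \<Longrightarrow> supp g \<subseteq> A \<Longrightarrow> supp (f - g) \<subseteq> A"
  using keys_diff[of f g] by blast

lemma supp_sum_subset: "(\<And>i. i \<in> I \<Longrightarrow> supp (f i) \<subseteq> A) \<Longrightarrow> supp (\<Sum>i\<in>I. f i) \<subseteq> A"
  using keys_sum[of f I] by blast

lemma supp_split:
  obtains f0 f1 where "f = f0 + f1" "supp f0 \<subseteq> supp f - A" "supp f1 \<subseteq> supp f \<inter> A"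
proof -
  define f0 where "f0 = (\<Sum>m\<in>supp f - A. Poly_Mapping.single m (coef f m))"
  define f1 where "f1 = (\<Sum>m\<in>supp f \<inter> A. Poly_Mapping.single m (coef f m))"
  have "(supp f - A) \<union> (supp f \<inter> A) = supp f" by blast
  then have "f = (\<Sum>m\<in>(supp f - A) \<union> (supp f \<inter> A). Poly_Mapping.single m (coef f m))"
    by (simp flip: cpoly_sum_monos)
  also have "\<dots> = f0 + f1" unfolding f0_def f1_def
    by (rule sum.union_disjoint) auto
  finally show thesis
    by (rule that) (auto simp: f0_def f1_def intro!: supp_sum_subset split: if_splits)
qed

lemma trunc_ideal_add:
  assumes "f \<in> trunc_ideal G Y N" "g \<in> trunc_ideal G Y N"
  shows "f + g \<in> trunc_ideal G Y N"
proof -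
  obtain a b a' b' where "f = a * G + b" "supp b \<subseteq> tail Y N" "g = a' * G + b'" "supp b' \<subseteq> tail Y N"
    using assms by (auto simp: trunc_ideal_def)
  then have "f + g = (a + a') * G + (b + b')" "supp (b + b') \<subseteq> tail Y N"
    using supp_add_subset[of b "tail Y N" b'] by (simp_all add: algebra_simps)
  then show ?thesis unfolding trunc_ideal_def by blast
qed

lemma trunc_ideal_mult:
  assumes "g \<in> trunc_ideal G Y N"
  shows "f * g \<in> trunc_ideal G Y N"
proof -
  obtain a b where "g = a * G + b" "supp b \<subseteq> tail Y N"
    using assms by (auto simp: trunc_ideal_def)
  then have "f * g = (f * a) * G + f * b" "supp (f * b) \<subseteq> tail Y N"
    using supp_mult_tail[of b Y N f] by (simp_all add: algebra_simps)
  then show ?thesis unfolding trunc_ideal_def by blast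
qed

lemma trunc_ideal_tail: "supp b \<subseteq> tail Y N \<Longrightarrow> b \<in> trunc_ideal G Y N"
  unfolding trunc_ideal_def by (rule CollectI, rule exI[of _ 0]) auto

lemma trunc_ideal_gen: "a * G \<in> trunc_ideal G Y N"
  unfolding trunc_ideal_def by (rule CollectI, rule exI[of _ a], rule exI[of _ 0]) auto

lemma trunc_ideal_0: "0 \<in> trunc_ideal G Y N"
  using trunc_ideal_gen[of 0] by simp

lemma trunc_ideal_uminus: "f \<in> trunc_ideal G Y N \<Longrightarrow> - f \<in> trunc_ideal G Y N"
  using trunc_ideal_mult[of f G Y N "- 1"] by simp

lemma trunc_ideal_diff:
  "f \<in> trunc_ideal G Y N \<Longrightarrow> g \<in> trunc_ideal G Y N \<Longrightarrow> f - g \<in> trunc_ideal G Y N"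
  using trunc_ideal_add[of f G Y N "- g"] trunc_ideal_uminus[of g G Y N] by simp

lemma trunc_ideal_mono:
  assumes "Y \<subseteq> Y'" "N' \<le> N" shows "trunc_ideal G Y N \<subseteq> trunc_ideal G Y' N'"
proof -
  have "tail Y N \<subseteq> tail Y' N'" using assms by (auto simp: tail_def)
  then show ?thesis unfolding trunc_ideal_def by blast
qed

definition mono_dvd :: "('s \<Rightarrow>\<^sub>0 nat) \<Rightarrow> ('s \<Rightarrow>\<^sub>0 nat) \<Rightarrow> bool" where
  "mono_dvd a m \<longleftrightarrow> (\<forall>i. expon a i \<le> expon m i)"

lemma mono_dvd_diff: "mono_dvd a m \<Longrightarrow> m = (m - a) + a"
  by (rule expon_le_imp_add) (simp add: mono_dvd_def)

definition standard :: "('s \<Rightarrow>\<^sub>0 nat) \<Rightarrow> 's set \<Rightarrow> nat \<Rightarrow> ('s::finite \<Rightarrow>\<^sub>0 nat) set" where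
  "standard \<alpha> Y N = {m. m \<notin> tail Y N \<and> \<not> mono_dvd \<alpha> m}"

lemma finite_standard: "finite (standard \<alpha> Y N)"
  by (rule finite_subset[OF _ finite_deg_le[of N]]) (auto simp: standard_def tail_def)

text \<open>
  If \<open>\<alpha>\<close> divides a monomial \<open>m\<close>, a multiple of \<open>G\<close> replaces \<open>m\<close> by larger monomials.  This
  process stops, because all but finitely many monomials have degree at least \<open>N\<close>.
\<close>

theorem standard_span:
  fixes f G :: "'s::finite cpoly"
  assumes G: "initial G \<alpha>"
  shows "\<exists>h. supp h \<subseteq> standard \<alpha> Y N \<and> f - h \<in> trunc_ideal G Y N"
proof -
  define red where "red f \<longleftrightarrow> (\<exists>h. supp h \<subseteq> standard \<alpha> Y N \<and> f - h \<in> trunc_ideal G Y N)" for f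
  have red_ideal: "red f" if "f \<in> trunc_ideal G Y N" for f
    unfolding red_def using that by (intro exI[of _ 0]) auto
  have red_add: "red (f + g)" if "red f" "red g" for f g
  proof -
    obtain h where h: "supp h \<subseteq> standard \<alpha> Y N" "f - h \<in> trunc_ideal G Y N"
      using \<open>red f\<close> unfolding red_def by auto
    obtain h' where h': "supp h' \<subseteq> standard \<alpha> Y N" "g - h' \<in> trunc_ideal G Y N"
      using \<open>red g\<close> unfolding red_def by auto
    from h h' have "supp (h + h') \<subseteq> standard \<alpha> Y N" "(f + g) - (h + h') \<in> trunc_ideal G Y N"
      using trunc_ideal_add[of "f - h" G Y N "g - h'"] supp_add_subset[of h _ h']
      by (simp_all add: algebra_simps)
    then show ?thesis unfolding red_def by blast
  qed
  have red_sum: "red (\<Sum>i\<in>I. F i)" if "finite I" "\<And>i. i \<in> I \<Longrightarrow> red (F i)" for I and F :: "_ \<Rightarrow> 's cpoly"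
    using that by (induct I) (auto intro: red_add red_ideal trunc_ideal_0)
  have red_single: "red (Poly_Mapping.single m c)" for m c
  proof (induct m arbitrary: c
      rule: measure_induct_rule[of "\<lambda>m :: 's \<Rightarrow>\<^sub>0 nat. card {m' :: 's \<Rightarrow>\<^sub>0 nat. tdeg m' < N \<and> mono_key m < mono_key m'}"])
    case (less m)
    consider "m \<in> tail Y N" | "m \<in> standard \<alpha> Y N" | "m \<notin> tail Y N" "mono_dvd \<alpha> m"
      by (auto simp: standard_def)
    then show ?case
    proof cases
      case 1
      then show ?thesis by (intro red_ideal trunc_ideal_tail) (cases "c = 0"; simp)
    next
      case 2
      then show ?thesis unfolding red_def
        by (intro exI[of _ "Poly_Mapping.single m c"]) (cases "c = 0"; simp add: trunc_ideal_0)
    next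
      case 3
      have a: "coef G \<alpha> \<noteq> 0" using G by (simp add: initial_def in_keys_iff)
      \<comment> \<open>the multiple of \<open>G\<close> whose initial term cancels the given one\<close>
      define q where "q = Poly_Mapping.single (m - \<alpha>) (- c / coef G \<alpha>)"
      define r where "r = Poly_Mapping.single m c + q * G"
      have m: "m = (m - \<alpha>) + \<alpha>" using 3(2) by (rule mono_dvd_diff)
      have "coef (q * G) ((m - \<alpha>) + \<alpha>) = coef q (m - \<alpha>) * coef G \<alpha>"
        by (rule coef_mult_unique) (auto simp: q_def split: if_splits)
      then have "coef (q * G) m = - c"
        using a m by (simp add: q_def)
      then have r_m: "coef r m = 0" by (simp add: r_def lookup_add)
      have r_less: "mono_key m < mono_key k" if k: "k \<in> supp r" for k
      proof -
        have "k \<noteq> m" using k r_m by (auto simp: in_keys_iff)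
        with k have "k \<in> supp (q * G)"
          by (auto simp: r_def in_keys_iff lookup_add lookup_single_not_eq)
        then obtain b where b: "b \<in> supp G" "k = (m - \<alpha>) + b"
          using supp_mult[of k q G] by (auto simp: q_def split: if_splits)
        then have "mono_key ((m - \<alpha>) + \<alpha>) \<le> mono_key k"
          using G by (simp add: mono_key_add initial_def)
        with \<open>k \<noteq> m\<close> m show ?thesis by (metis mono_key_eq_iff order_le_less)
      qed
      have "red (Poly_Mapping.single k d)" if "mono_key m < mono_key k" for k d
      proof (cases "tdeg k < N")
        case True
        have "{m'. tdeg m' < N \<and> mono_key k < mono_key m'} \<subset> {m' :: 's \<Rightarrow>\<^sub>0 nat. tdeg m' < N \<and> mono_key m < mono_key m'}"
          using that True by (auto intro: less_trans)
        moreover have "finite {m' :: 's \<Rightarrow>\<^sub>0 nat. tdeg m' < N \<and> mono_key m < mono_key m'}"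
          by (rule finite_subset[OF _ finite_deg_le[of N]]) auto
        ultimately show ?thesis by (intro less psubset_card_mono)
      next
        case False
        then have "k \<in> tail Y N" by (simp add: tail_def)
        then show ?thesis by (intro red_ideal trunc_ideal_tail) (cases "d = 0"; simp)
      qed
      with r_less have "red (\<Sum>k\<in>supp r. Poly_Mapping.single k (coef r k))"
        by (intro red_sum) auto
      then have "red r" by (simp flip: cpoly_sum_monos)
      moreover have "red ((- q) * G)" by (intro red_ideal trunc_ideal_gen)
      ultimately have "red (r + (- q) * G)" by (rule red_add)
      then show ?thesis by (simp add: r_def)
    qed
  qed
  have "red (\<Sum>m\<in>supp f. Poly_Mapping.single m (coef f m))"
    by (intro red_sum red_single) auto
  then have "red f" by (simp flip: cpoly_sum_monos)
  then show ?thesis unfolding red_def .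
qed

text \<open>
  A multiple of \<open>G\<close> has an initial monomial divisible by \<open>\<alpha>\<close>, which is not standard.  The hypothesis
  that \<open>\<alpha>\<close> avoids \<open>Y\<close> ensures that \<open>\<alpha>\<close> stays the initial monomial after the variables in \<open>Y\<close> are
  set to zero.
\<close>

theorem standard_independent:
  assumes G: "initial G \<alpha>" and \<alpha>: "\<And>v. v \<in> Y \<Longrightarrow> expon \<alpha> v = 0"
    and h: "supp h \<subseteq> standard \<alpha> Y N" "h \<in> trunc_ideal G Y N"
  shows "h = 0"
proof -
  obtain a b where ab: "h = a * G + b" "supp b \<subseteq> tail Y N"
    using h(2) by (auto simp: trunc_ideal_def)
  \<comment> \<open>the part of \<open>a\<close> that involves a variable of \<open>Y\<close> contributes only to the tail\<close>
  obtain a0 a1 where a: "a = a0 + a1"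
    and a0: "supp a0 \<subseteq> supp a - {m. \<exists>v\<in>Y. 0 < expon m v}"
    and a1: "supp a1 \<subseteq> supp a \<inter> {m. \<exists>v\<in>Y. 0 < expon m v}"
    by (rule supp_split)
  define b' where "b' = G * a1 + b"
  have "supp a1 \<subseteq> tail Y N" using a1 by (auto simp: tail_def)
  then have b': "supp b' \<subseteq> tail Y N"
    unfolding b'_def by (intro supp_add_subset supp_mult_tail ab)
  have h_eq: "h = a0 * G + b'"
    unfolding ab(1) a b'_def by (simp add: algebra_simps)
  \<comment> \<open>the initial monomial of \<open>a0 * G\<close> can only be cancelled by the tail, and no variable of \<open>Y\<close> occurs
    in it, so its degree is at least \<open>N\<close>; the order being graded, so is the degree of every term\<close>
  have "supp (a0 * G) \<subseteq> tail Y N"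
  proof (cases "a0 = 0")
    case False
    then obtain \<beta> where \<beta>: "initial a0 \<beta>" by (rule ex_initial)
    then have \<gamma>: "initial (a0 * G) (\<beta> + \<alpha>)" by (intro initial_mult G)
    have "N \<le> tdeg (\<beta> + \<alpha>)"
    proof (rule ccontr)
      assume "\<not> ?thesis"
      moreover have "\<beta> \<in> supp a0" using \<beta> by (simp add: initial_def)
      ultimately have "\<beta> + \<alpha> \<notin> tail Y N"
        using a0 \<alpha> by (auto simp: tail_def lookup_add)
      with b' have "coef b' (\<beta> + \<alpha>) = 0" by (auto simp: in_keys_iff)
      then have "\<beta> + \<alpha> \<in> supp h"
        using \<gamma> by (simp add: h_eq initial_def in_keys_iff lookup_add)
      with h(1) show False by (auto simp: standard_def mono_dvd_def lookup_add)
    qed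
    then have "N \<le> tdeg m" if "m \<in> supp (a0 * G)" for m
      using \<gamma> that tdeg_le_if_mono_key_le unfolding initial_def by (meson order_trans)
    then show ?thesis by (auto simp: tail_def)
  qed simp
  with b' have "supp h \<subseteq> tail Y N"
    unfolding h_eq by (intro supp_add_subset)
  with h(1) have "supp h \<subseteq> {}" unfolding standard_def by blast
  then show ?thesis by simp
qed

section \<open>Ideals of the polynomial ring\<close>

definition poly_ideal :: "'s cpoly set \<Rightarrow> bool" where
  "poly_ideal I \<longleftrightarrow> 0 \<in> I \<and> (\<forall>f\<in>I. \<forall>g\<in>I. f + g \<in> I) \<and> (\<forall>f. \<forall>g\<in>I. f * g \<in> I)"

definition poly_prime :: "'s cpoly set \<Rightarrow> bool" where
  "poly_prime Q \<longleftrightarrow> poly_ideal Q \<and> 1 \<notin> Q \<and> (\<forall>f g. f * g \<in> Q \<longrightarrow> f \<in> Q \<or> g \<in> Q)"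

lemma poly_idealD:
  assumes "poly_ideal I"
  shows "0 \<in> I" "f \<in> I \<Longrightarrow> g \<in> I \<Longrightarrow> f + g \<in> I" "g \<in> I \<Longrightarrow> f * g \<in> I"
    "f \<in> I \<Longrightarrow> g \<in> I \<Longrightarrow> f - g \<in> I"
proof -
  show *: "0 \<in> I" "\<And>f g. f \<in> I \<Longrightarrow> g \<in> I \<Longrightarrow> f + g \<in> I" "\<And>f g. g \<in> I \<Longrightarrow> f * g \<in> I"
    using assms by (auto simp: poly_ideal_def)
  show "f \<in> I \<Longrightarrow> g \<in> I \<Longrightarrow> f - g \<in> I"
    using *(2)[of f "- 1 * g"] *(3)[of g "- 1"] by simp
qed

lemma poly_ideal_sum: "poly_ideal I \<Longrightarrow> (\<And>i. i \<in> A \<Longrightarrow> F i \<in> I) \<Longrightarrow> (\<Sum>i\<in>A. F i) \<in> I"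
  by (induct A rule: infinite_finite_induct) (auto simp: poly_idealD)

lemma poly_ideal_var_multiples:
  assumes I: "poly_ideal I" and f: "\<And>m. m \<in> supp f \<Longrightarrow> \<exists>v. 0 < expon m v \<and> pvar v \<in> I"
  shows "f \<in> I"
proof -
  have "(\<Sum>m\<in>supp f. Poly_Mapping.single m (coef f m)) \<in> I"
  proof (rule poly_ideal_sum[OF I])
    fix m assume "m \<in> supp f"
    then obtain v where v: "0 < expon m v" "pvar v \<in> I" using f by blast
    have m: "m = (m - unit_expon v) + unit_expon v" using v(1) by (rule divide_var)
    have "Poly_Mapping.single (m - unit_expon v) (coef f m) * pvar v \<in> I"
      using I v(2) by (rule poly_idealD)
    then show "Poly_Mapping.single m (coef f m) \<in> I" by (simp add: mult_single flip: m)
  qed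
  then show ?thesis by (simp flip: cpoly_sum_monos)
qed

lemma poly_ideal_trunc_ideal: "poly_ideal (trunc_ideal G Y N)"
  by (simp add: poly_ideal_def trunc_ideal_0 trunc_ideal_add trunc_ideal_mult)

lemma poly_ideal_INT: "(\<And>N. poly_ideal (I N)) \<Longrightarrow> poly_ideal (\<Inter>N. I N)"
  by (auto simp: poly_ideal_def)

lemma poly_prime_0: "poly_prime {0 :: 's::finite cpoly}"
proof -
  have "f * g \<noteq> 0" if nz: "f \<noteq> 0" "g \<noteq> 0" for f g :: "'s cpoly"
  proof -
    obtain a b where "initial f a" "initial g b" using nz by (meson ex_initial)
    then have "initial (f * g) (a + b)" by (rule initial_mult)
    then show ?thesis by (auto simp: initial_def)
  qed
  then show ?thesis by (auto simp: poly_prime_def poly_ideal_def)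
qed

lemma poly_prime_power: "poly_prime Q \<Longrightarrow> g ^ e * f \<in> Q \<Longrightarrow> g \<notin> Q \<Longrightarrow> f \<in> Q"
  by (induct e) (auto simp: poly_prime_def mult.assoc)

lemma poly_prime_const: "poly_prime Q \<Longrightarrow> poly_const c \<in> Q \<Longrightarrow> c = 0"
proof (rule ccontr)
  assume Q: "poly_prime Q" "poly_const c \<in> Q" "c \<noteq> 0"
  then have "poly_const (1 / c) * poly_const c \<in> Q" by (simp add: poly_prime_def poly_ideal_def)
  with Q show False by (simp add: mult_single poly_prime_def)
qed

subsection \<open>Chains of prime ideals\<close>

text \<open>
  The upper bound on the length of prime chains follows Coquand and Lombardi: instead of the
  primes one keeps elements that witness their strict inclusions.
\<close>

inductive witness_chain :: "'s cpoly set \<Rightarrow> 's cpoly list \<Rightarrow> bool" where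
  Nil: "poly_prime Q \<Longrightarrow> witness_chain Q []"
| Cons: "poly_prime Q \<Longrightarrow> g \<notin> Q \<Longrightarrow> Q \<subseteq> Q' \<Longrightarrow> g \<in> Q' \<Longrightarrow> witness_chain Q' gs \<Longrightarrow> witness_chain Q (g # gs)"

lemma ex_witness_chain:
  assumes "\<And>i. i \<le> k \<Longrightarrow> poly_prime (Q i)" "\<And>i. i < k \<Longrightarrow> Q i \<subset> Q (Suc i)"
  shows "\<exists>gs. length gs = k \<and> witness_chain (Q 0) gs"
  using assms
proof (induct k arbitrary: Q)
  case 0
  then show ?case by (auto intro: witness_chain.Nil)
next
  case (Suc k)
  obtain gs where gs: "length gs = k" "witness_chain (Q (Suc 0)) gs"
    using Suc(1)[of "\<lambda>i. Q (Suc i)"] Suc(2,3) by auto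
  obtain g where "g \<in> Q (Suc 0)" "g \<notin> Q 0" using Suc(3)[of 0] by auto
  then have "witness_chain (Q 0) (g # gs)"
    using Suc(2)[of 0] Suc(3)[of 0] gs by (intro witness_chain.Cons[of _ _ "Q (Suc 0)"]) auto
  with gs show ?case by (intro exI[of _ "g # gs"]) simp
qed

fun power_prod :: "'s cpoly list \<Rightarrow> nat list \<Rightarrow> 's cpoly" where
  "power_prod (g # gs) (e # es) = g ^ e * power_prod gs es"
| "power_prod _ _ = 1"

definition exponents :: "nat \<Rightarrow> nat \<Rightarrow> nat list set" where
  "exponents N r = {es. set es \<subseteq> {..N} \<and> length es = r}"

lemma finite_exponents: "finite (exponents N r)"
  unfolding exponents_def by (rule finite_lists_length_eq) simp

lemma card_exponents: "card (exponents N r) = (N + 1) ^ r"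
  unfolding exponents_def by (subst card_lists_length_eq) auto

lemma exponents_0: "exponents N 0 = {[]}"
  by (auto simp: exponents_def)

lemma exponents_Suc: "exponents N (Suc r) = (\<lambda>(e, es). e # es) ` ({..N} \<times> exponents N r)"
  by (auto simp: exponents_def length_Suc_conv image_iff)

lemma sum_exponents_Suc:
  "(\<Sum>es\<in>exponents N (Suc r). F es) = (\<Sum>e\<le>N. \<Sum>es\<in>exponents N r. F (e # es))"
  unfolding exponents_Suc by (subst sum.reindex) (auto simp: inj_on_def sum.cartesian_product split_def)

text \<open>
  Power products of the witnesses are linearly independent.  In a relation with values in \<open>Q\<close>,
  factor out the least power of the first witness \<open>g\<close> with a non-zero coefficient; as \<open>g \<notin> Q\<close> and \<open>Q\<close>
  is prime, the remaining factor is in \<open>Q\<close>.  It consists of the lowest coefficient and a multiple of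
  \<open>g \<in> Q'\<close>, so the lowest coefficient is in \<open>Q'\<close> and is a shorter relation.
\<close>

lemma power_prod_independent:
  assumes "witness_chain Q gs"
    and "(\<Sum>es\<in>exponents N (length gs). poly_const (c es) * power_prod gs es) \<in> Q"
    and "es \<in> exponents N (length gs)"
  shows "c es = 0"
  using assms
proof (induct arbitrary: c es rule: witness_chain.induct)
  case (Nil Q)
  then show ?case by (auto simp: exponents_0 dest: poly_prime_const)
next
  case (Cons Q g Q' gs)
  define h where "h e = (\<Sum>es\<in>exponents N (length gs). poly_const (c (e # es)) * power_prod gs es)" for e
  have Q: "poly_ideal Q" using Cons(1) by (simp add: poly_prime_def)
  have Q': "poly_ideal Q'" using Cons(5) by cases (auto simp: poly_prime_def)
  have sum: "(\<Sum>e\<le>N. g ^ e * h e) \<in> Q"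
    using Cons(7) by (simp add: sum_exponents_Suc h_def sum_distrib_left algebra_simps)
  \<comment> \<open>induction on the power \<open>e\<close> of \<open>g\<close>: when \<open>e\<close> is treated, the lower powers are known to be absent\<close>
  have zero: "e \<le> N \<Longrightarrow> es \<in> exponents N (length gs) \<Longrightarrow> c (e # es) = 0" for e es
  proof (induct e arbitrary: es rule: less_induct)
    case (less e)
    have h_less: "h e' = 0" if "e' < e" for e'
      unfolding h_def using less(1)[OF that] that less(2) by (simp add: sum.neutral)
    have "(\<Sum>e\<le>N. g ^ e * h e) = (\<Sum>i\<in>{e..N}. g ^ i * h i)"
      using h_less by (intro sum.mono_neutral_right) auto
    also have "\<dots> = (\<Sum>i\<in>{e..N}. g ^ e * (g ^ (i - e) * h i))"
      by (intro sum.cong) (auto simp flip: mult.assoc power_add)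
    also have "\<dots> = g ^ e * (\<Sum>i\<in>{e..N}. g ^ (i - e) * h i)"
      by (simp add: sum_distrib_left)
    also have "(\<Sum>i\<in>{e..N}. g ^ (i - e) * h i) = h e + (\<Sum>i\<in>{Suc e..N}. g ^ (i - e) * h i)"
      using less(2) by (subst sum.atLeast_Suc_atMost) auto
    finally have "h e + (\<Sum>i\<in>{Suc e..N}. g ^ (i - e) * h i) \<in> Q"
      using sum poly_prime_power[OF Cons(1) _ Cons(2)] by simp
    then have "h e + (\<Sum>i\<in>{Suc e..N}. g ^ (i - e) * h i) \<in> Q'"
      using Cons(3) by (rule rev_subsetD)
    moreover have "(\<Sum>i\<in>{Suc e..N}. g ^ (i - e) * h i) \<in> Q'"
    proof (rule poly_ideal_sum[OF Q'])
      fix i assume "i \<in> {Suc e..N}"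
      then obtain k where "i - e = Suc k" by (cases "i - e") auto
      then have "g ^ (i - e) * h i = (g ^ k * h i) * g" by (simp add: ac_simps)
      also have "\<dots> \<in> Q'" using Q' Cons(4) by (rule poly_idealD)
      finally show "g ^ (i - e) * h i \<in> Q'" .
    qed
    ultimately have "(h e + (\<Sum>i\<in>{Suc e..N}. g ^ (i - e) * h i)) -
        (\<Sum>i\<in>{Suc e..N}. g ^ (i - e) * h i) \<in> Q'"
      by (rule poly_idealD(4)[OF Q'])
    then have "h e \<in> Q'" by simp
    then show ?case
      unfolding h_def using Cons(6)[of "\<lambda>es. c (e # es)"] less(3) by blast
  qed
  from Cons(8) obtain e es' where "es = e # es'" "e \<le> N" "es' \<in> exponents N (length gs)"
    by (auto simp: exponents_Suc)
  with zero show ?case by simp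
qed

text \<open>
  A homogeneous linear system with more unknowns than equations has a non-trivial solution, by
  Gaussian elimination of one equation and one unknown at a time.
\<close>

lemma ex_linear_relation:
  fixes a :: "'b \<Rightarrow> 'k \<Rightarrow> complex"
  assumes "finite K" "finite B" "card K < card B"
  shows "\<exists>c. (\<exists>b\<in>B. c b \<noteq> 0) \<and> (\<forall>k\<in>K. (\<Sum>b\<in>B. c b * a b k) = 0)"
  using assms
proof (induct K arbitrary: B a rule: finite_induct)
  case empty
  then obtain b where "b \<in> B" by fastforce
  then show ?case by (intro exI[of _ "\<lambda>_. 1"]) auto
next
  case (insert k K)
  show ?case
  proof (cases "\<forall>b\<in>B. a b k = 0")
    case True
    have "card K < card B" using insert by simp
    then obtain c where "\<exists>b\<in>B. c b \<noteq> 0" "\<forall>k\<in>K. (\<Sum>b\<in>B. c b * a b k) = 0"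
      using insert(3)[of B a] insert(4) by auto
    with True show ?thesis by (intro exI[of _ c]) simp
  next
    case False
    then obtain b0 where b0: "b0 \<in> B" "a b0 k \<noteq> 0" by auto
    define t where "t b = a b k / a b0 k" for b
    have "card K < card (B - {b0})" using insert b0 by simp
    then obtain c where c: "\<exists>b\<in>B - {b0}. c b \<noteq> 0"
      "\<forall>k\<in>K. (\<Sum>b\<in>B - {b0}. c b * (a b k - t b * a b0 k)) = 0"
      using insert(3)[of "B - {b0}" "\<lambda>b k. a b k - t b * a b0 k"] insert(4) by auto
    define c' where "c' b = (if b = b0 then - (\<Sum>b\<in>B - {b0}. c b * t b) else c b)" for b
    have eq: "(\<Sum>b\<in>B. c' b * a b l) = (\<Sum>b\<in>B - {b0}. c b * (a b l - t b * a b0 l))" for l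
    proof -
      have "(\<Sum>b\<in>B. c' b * a b l) = c' b0 * a b0 l + (\<Sum>b\<in>B - {b0}. c' b * a b l)"
        using insert(4) b0(1) by (rule sum.remove)
      also have "(\<Sum>b\<in>B - {b0}. c' b * a b l) = (\<Sum>b\<in>B - {b0}. c b * a b l)"
        by (rule sum.cong) (auto simp: c'_def)
      also have "c' b0 * a b0 l = - (\<Sum>b\<in>B - {b0}. c b * (t b * a b0 l))"
        by (simp add: c'_def sum_distrib_right mult.assoc)
      finally show ?thesis
        by (simp add: right_diff_distrib sum_subtractf)
    qed
    have "(\<Sum>b\<in>B. c' b * a b k) = 0"
      unfolding eq using b0(2) by (simp add: t_def)
    moreover have "\<exists>b\<in>B. c' b \<noteq> 0" using c(1) by (auto simp: c'_def)
    ultimately show ?thesis using c(2) by (intro exI[of _ c']) (auto simp: eq)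
  qed
qed

definition expon_bounded :: "nat \<Rightarrow> 's cpoly \<Rightarrow> bool" where
  "expon_bounded d f \<longleftrightarrow> (\<forall>m\<in>supp f. \<forall>i. expon m i \<le> d)"

lemma expon_bounded_mult: "expon_bounded d f \<Longrightarrow> expon_bounded d' g \<Longrightarrow> expon_bounded (d + d') (f * g)"
  unfolding expon_bounded_def by (auto dest!: supp_mult simp: lookup_add intro!: add_mono)

lemma expon_bounded_1: "expon_bounded 0 1"
  by (simp add: expon_bounded_def)

lemma expon_bounded_power: "expon_bounded d f \<Longrightarrow> expon_bounded (e * d) (f ^ e)"
  by (induct e) (auto intro: expon_bounded_1 expon_bounded_mult)

lemma expon_bounded_mono: "expon_bounded d f \<Longrightarrow> d \<le> d' \<Longrightarrow> expon_bounded d' f"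
  unfolding expon_bounded_def by (meson order_trans)

lemma ex_expon_bounded: "\<exists>d. expon_bounded d (f :: 's::finite cpoly)"
proof (intro exI[of _ "\<Sum>m\<in>supp f. tdeg m"], unfold expon_bounded_def, intro ballI allI)
  fix m i assume "m \<in> supp f"
  then have "tdeg m \<le> (\<Sum>m\<in>supp f. tdeg m)" by (intro member_le_sum) auto
  with expon_le_deg show "expon m i \<le> (\<Sum>m\<in>supp f. tdeg m)" by (rule order_trans)
qed

lemma expon_bounded_power_prod:
  assumes "\<And>g. g \<in> set gs \<Longrightarrow> expon_bounded d g" "es \<in> exponents N (length gs)"
  shows "expon_bounded (length gs * (N * d)) (power_prod gs es)"
  using assms
proof (induct gs arbitrary: es)
  case Nil
  then show ?case by (simp add: expon_bounded_1)
next
  case (Cons g gs)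
  obtain e es' where es: "es = e # es'" "e \<le> N" "es' \<in> exponents N (length gs)"
    using Cons(3) by (auto simp: exponents_Suc)
  have "expon_bounded (e * d) (g ^ e)" using Cons(2) by (intro expon_bounded_power) simp
  then have "expon_bounded (N * d) (g ^ e)"
    by (rule expon_bounded_mono) (use es in simp)
  moreover have "expon_bounded (length gs * (N * d)) (power_prod gs es')"
    using Cons es by simp
  ultimately show ?case unfolding es(1) by (auto dest: expon_bounded_mult)
qed

lemma box_card:
  fixes K :: "('s::finite \<Rightarrow>\<^sub>0 nat) set"
  assumes "K = {m. \<forall>i. expon m i \<le> d}"
  shows "finite K" "card K \<le> (d + 1) ^ CARD('s)"
proof -
  have sub: "Poly_Mapping.lookup ` K \<subseteq> (\<Pi>\<^sub>E i\<in>UNIV. {..d})" using assms by auto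
  have inj: "inj_on Poly_Mapping.lookup K" by (rule inj_onI) (simp add: poly_mapping_eqI)
  have fin: "finite (\<Pi>\<^sub>E i\<in>(UNIV :: 's set). {..d})" by (simp add: finite_PiE)
  show "finite K" using finite_subset[OF sub fin] inj by (rule finite_imageD)
  have "card K \<le> card (\<Pi>\<^sub>E i\<in>(UNIV :: 's set). {..d})"
    using card_mono[OF fin sub] card_image[OF inj] by simp
  then show "card K \<le> (d + 1) ^ CARD('s)" by (simp add: card_PiE)
qed

text \<open>
  Counting contradicts more witnesses than variables.  The \<open>r\<close> witnesses have \<open>(N + 1) ^ r\<close> power
  products with exponents at most \<open>N\<close>, and these involve only on the order of \<open>N ^ CARD('s)\<close> monomials.
\<close>

lemma witness_chain_length:
  fixes Q :: "'s::finite cpoly set"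
  assumes "witness_chain Q gs"
  shows "length gs \<le> CARD('s)"
proof (rule ccontr)
  assume "\<not> ?thesis"
  then have len: "CARD('s) < length gs" by simp
  define r where "r = length gs"
  have "\<exists>d. \<forall>g\<in>set gs. expon_bounded d g"
  proof (induct gs)
    case (Cons g gs)
    then obtain d d' where "\<forall>g\<in>set gs. expon_bounded d g" "expon_bounded d' g"
      using ex_expon_bounded by blast
    then have "\<forall>g\<in>set (g # gs). expon_bounded (d + d') g"
      by (auto intro: expon_bounded_mono)
    then show ?case by blast
  qed simp
  then obtain d where d: "\<And>g. g \<in> set gs \<Longrightarrow> expon_bounded d g" by blast
  \<comment> \<open>\<open>N\<close> is large enough for \<open>N + 1\<close> to exceed the constant factor \<open>E ^ CARD('s)\<close> in the count\<close>
  define E where "E = r * d + 1"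
  define N where "N = E ^ CARD('s)"
  define K where "K = {m :: 's \<Rightarrow>\<^sub>0 nat. \<forall>i. expon m i \<le> r * (N * d)}"
  have "card K \<le> (r * (N * d) + 1) ^ CARD('s)" by (rule box_card) (rule K_def)
  also have "\<dots> \<le> (E * (N + 1)) ^ CARD('s)"
    by (intro power_mono) (auto simp: E_def algebra_simps)
  also have "\<dots> = N * (N + 1) ^ CARD('s)" unfolding power_mult_distrib by (simp flip: N_def)
  also have "\<dots> < (N + 1) ^ Suc (CARD('s))" by simp
  also have "\<dots> \<le> (N + 1) ^ r" using len by (intro power_increasing) (auto simp: r_def)
  finally have "card K < card (exponents N r)" by (simp add: card_exponents)
  then obtain c where c: "\<exists>es\<in>exponents N r. c es \<noteq> 0"
    "\<forall>k\<in>K. (\<Sum>es\<in>exponents N r. c es * coef (power_prod gs es) k) = 0"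
    using ex_linear_relation[of K "exponents N r" "\<lambda>es k. coef (power_prod gs es) k"]
      box_card(1)[OF K_def] finite_exponents by blast
  have "(\<Sum>es\<in>exponents N r. poly_const (c es) * power_prod gs es) = 0"
  proof (rule poly_mapping_eqI)
    fix k
    have *: "coef (\<Sum>es\<in>exponents N r. poly_const (c es) * power_prod gs es) k =
        (\<Sum>es\<in>exponents N r. c es * coef (power_prod gs es) k)"
      unfolding lookup_sum
    proof (rule sum.cong)
      fix es
      show "coef (poly_const (c es) * power_prod gs es) k = c es * coef (power_prod gs es) k"
        by (rule coef_const_mult)
    qed simp
    have "coef (power_prod gs es) k = 0" if "k \<notin> K" "es \<in> exponents N r" for es
    proof -
      have "expon_bounded (r * (N * d)) (power_prod gs es)"
        unfolding r_def by (rule expon_bounded_power_prod) (use d that r_def in auto)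
      with that(1) show ?thesis by (auto simp: K_def expon_bounded_def in_keys_iff)
    qed
    then show "coef (\<Sum>es\<in>exponents N r. poly_const (c es) * power_prod gs es) k = coef 0 k"
      unfolding * using c(2) by (cases "k \<in> K") auto
  qed
  moreover have "poly_ideal Q" using assms by cases (auto simp: poly_prime_def)
  ultimately have "(\<Sum>es\<in>exponents N (length gs). poly_const (c es) * power_prod gs es) \<in> Q"
    by (simp add: r_def poly_idealD)
  with power_prod_independent[OF assms this] c(1) show False by (auto simp: r_def)
qed

theorem poly_prime_chain_length:
  fixes Q :: "nat \<Rightarrow> 's::finite cpoly set"
  assumes "\<And>i. i \<le> k \<Longrightarrow> poly_prime (Q i)" "\<And>i. i < k \<Longrightarrow> Q i \<subset> Q (Suc i)"
  shows "k \<le> CARD('s)"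
  using ex_witness_chain[of k Q] assms witness_chain_length by blast

subsection \<open>Local primes on a smooth hypersurface\<close>

lemma coef_0_trunc_ideal:
  assumes "f \<in> trunc_ideal G Y N" "coef G 0 = 0" "N \<ge> 1"
  shows "coef f 0 = 0"
proof -
  obtain a b where "f = a * G + b" "supp b \<subseteq> tail Y N"
    using assms(1) by (auto simp: trunc_ideal_def)
  moreover have "0 \<notin> tail Y N" using assms(3) by (simp add: tail_def)
  ultimately show ?thesis
    using assms(2) by (auto simp: lookup_add coef_mult_0 in_keys_iff subset_iff)
qed

lemma coef_0_initial:
  assumes "initial G \<alpha>" "\<alpha> \<noteq> 0"
  shows "coef G 0 = 0"
proof (rule ccontr)
  assume "\<not> ?thesis"
  then have "0 \<in> supp G" by (simp add: in_keys_iff)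
  then have "mono_key \<alpha> \<le> mono_key (0 :: 'a \<Rightarrow>\<^sub>0 nat)" using assms(1) by (simp add: initial_def)
  then have "tdeg \<alpha> \<le> tdeg (0 :: 'a \<Rightarrow>\<^sub>0 nat)" by (rule tdeg_le_if_mono_key_le)
  with assms(2) show False by simp
qed

text \<open>
  By Krull's intersection theorem these are the polynomials that lie in \<open>(G, Y)\<close> locally at the
  origin.  The description by truncations makes the normal forms applicable.
\<close>

definition local_prime :: "'s::finite cpoly \<Rightarrow> 's set \<Rightarrow> 's cpoly set" where
  "local_prime G Y = (\<Inter>N. trunc_ideal G Y N)"

text \<open>
  When the initial monomial is a variable, the standard monomials are the monomials in the remaining
  variables, and they are closed under multiplication except for their degree bound.  So two
  polynomials outside the ideal have non-zero normal forms to a sufficiently high order, and the product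
  of the normal forms is again a normal form, up to terms of high degree; its initial monomial shows
  that it does not vanish.
\<close>

lemma poly_prime_local_prime:
  fixes G :: "'s::finite cpoly"
  assumes G: "initial G (unit_expon j)" and j: "j \<notin> Y"
  shows "poly_prime (local_prime G Y)"
  unfolding poly_prime_def
proof (intro conjI allI impI)
  show "poly_ideal (local_prime G Y)"
    unfolding local_prime_def by (intro poly_ideal_INT poly_ideal_trunc_ideal)
  have "unit_expon j \<noteq> 0"
    by (metis tdeg_unit_expon tdeg_zero zero_neq_one)
  then have "1 \<notin> trunc_ideal G Y 1"
    using coef_0_trunc_ideal[of 1 G Y 1] coef_0_initial[OF G] by auto
  then show "1 \<notin> local_prime G Y" by (auto simp: local_prime_def)
  fix f g assume fg: "f * g \<in> local_prime G Y"
  have \<alpha>: "expon (unit_expon j) v = 0" if "v \<in> Y" for v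
    using that j by (auto simp: lookup_single when_def)
  have approx: "\<exists>h \<beta>. supp h \<subseteq> standard (unit_expon j) Y N \<and> f - h \<in> trunc_ideal G Y N \<and>
      initial h \<beta> \<and> tdeg \<beta> < N1" if f: "f \<notin> trunc_ideal G Y N1" and N: "N1 \<le> N" for f N1 N
  proof -
    obtain h where h: "supp h \<subseteq> standard (unit_expon j) Y N" "f - h \<in> trunc_ideal G Y N"
      using standard_span[OF G] by blast
    have "f - h \<in> trunc_ideal G Y N1" using h(2) trunc_ideal_mono[of Y Y N1 N] N by blast
    then have h_N1: "h \<notin> trunc_ideal G Y N1"
      using f trunc_ideal_add[of "f - h" G Y N1 h] by auto
    then have "h \<noteq> 0" using trunc_ideal_0 by blast
    then obtain \<beta> where \<beta>: "initial h \<beta>" by (rule ex_initial)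
    have "tdeg \<beta> < N1"
    proof (rule ccontr)
      assume "\<not> ?thesis"
      then have "supp h \<subseteq> tail Y N1"
        using \<beta> tdeg_le_if_mono_key_le by (fastforce simp: initial_def tail_def)
      with h_N1 show False by (simp add: trunc_ideal_tail)
    qed
    with h \<beta> show ?thesis by blast
  qed
  show "f \<in> local_prime G Y \<or> g \<in> local_prime G Y"
  proof (rule ccontr)
    assume "\<not> ?thesis"
    then obtain N1 N2 where N: "f \<notin> trunc_ideal G Y N1" "g \<notin> trunc_ideal G Y N2"
      by (auto simp: local_prime_def)
    \<comment> \<open>to this order the product of the two initial monomials is still visible\<close>
    define N where "N = N1 + N2"
    obtain h \<beta> where h: "supp h \<subseteq> standard (unit_expon j) Y N" "f - h \<in> trunc_ideal G Y N"
      "initial h \<beta>" "tdeg \<beta> < N1"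
      using approx[OF N(1), of N] by (auto simp: N_def)
    obtain h' \<beta>' where h': "supp h' \<subseteq> standard (unit_expon j) Y N" "g - h' \<in> trunc_ideal G Y N"
      "initial h' \<beta>'" "tdeg \<beta>' < N2"
      using approx[OF N(2), of N] by (auto simp: N_def)
    have "f * g \<in> trunc_ideal G Y N" using fg by (simp add: local_prime_def)
    then have "f * g - (f * (g - h') + h' * (f - h)) \<in> trunc_ideal G Y N"
      by (rule trunc_ideal_diff) (intro trunc_ideal_add trunc_ideal_mult h(2) h'(2))
    then have hh': "h * h' \<in> trunc_ideal G Y N" by (simp add: algebra_simps)
    obtain u w where uw: "h * h' = u + w"
      and u: "supp u \<subseteq> supp (h * h') - {m. N \<le> tdeg m}"
      and w: "supp w \<subseteq> supp (h * h') \<inter> {m. N \<le> tdeg m}"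
      by (rule supp_split)
    have "w \<in> trunc_ideal G Y N" using w by (intro trunc_ideal_tail) (auto simp: tail_def)
    then have "(u + w) - w \<in> trunc_ideal G Y N" using hh' unfolding uw by (rule trunc_ideal_diff[rotated])
    then have "u \<in> trunc_ideal G Y N" by simp
    moreover have "supp u \<subseteq> standard (unit_expon j) Y N"
    proof
      fix m assume m: "m \<in> supp u"
      then obtain a b where "a \<in> supp h" "b \<in> supp h'" "m = a + b" using u supp_mult by blast
      then have "m = a + b" "a \<in> standard (unit_expon j) Y N" "b \<in> standard (unit_expon j) Y N"
        using h(1) h'(1) by auto
      moreover have dvd_j: "mono_dvd (unit_expon j) k \<longleftrightarrow> 0 < expon k j" for k
        by (auto simp: mono_dvd_def lookup_single when_def Suc_le_eq)
      ultimately show "m \<in> standard (unit_expon j) Y N"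
        using m u by (auto simp: standard_def tail_def lookup_add)
    qed
    ultimately have "u = 0" by (intro standard_independent[OF G \<alpha>])
    moreover have "initial (h * h') (\<beta> + \<beta>')" using h(3) h'(3) by (rule initial_mult)
    ultimately have "\<beta> + \<beta>' \<in> supp w" unfolding uw by (simp add: initial_def)
    with w h(4) h'(4) show False by (auto simp: N_def)
  qed
qed

text \<open>
  The variable \<open>v\<close> is a standard monomial before it is adjoined, hence not in the smaller ideal.
\<close>

lemma local_prime_strict_mono:
  fixes G :: "'s::finite cpoly"
  assumes G: "initial G (unit_expon j)" and j: "j \<notin> insert v Y" and v: "v \<notin> Y"
  shows "local_prime G Y \<subset> local_prime G (insert v Y)"
proof
  show "local_prime G Y \<subseteq> local_prime G (insert v Y)"
    unfolding local_prime_def using trunc_ideal_mono[OF subset_insertI order_refl] by fast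
  have "pvar v \<in> local_prime G (insert v Y)"
    unfolding local_prime_def by (auto intro!: trunc_ideal_tail simp: tail_def)
  moreover have "pvar v \<notin> trunc_ideal G Y 2"
  proof
    assume "pvar v \<in> trunc_ideal G Y 2"
    moreover have "supp (pvar v) \<subseteq> standard (unit_expon j) Y 2"
      using j v by (auto simp: standard_def tail_def mono_dvd_def lookup_single when_def)
    moreover have "expon (unit_expon j) u = 0" if "u \<in> Y" for u
      using that j by (auto simp: lookup_single when_def)
    ultimately have "pvar v = 0" by (intro standard_independent[OF G])
    then show False by (metis lookup_single_eq lookup_zero zero_neq_one)
  qed
  ultimately show "local_prime G Y \<noteq> local_prime G (insert v Y)"
    by (auto simp: local_prime_def)
qed

lemma local_prime_gen: "G \<in> local_prime G Y"
  using trunc_ideal_gen[of 1 G] by (simp add: local_prime_def)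

subsection \<open>Finite generation of ideals\<close>

text \<open>
  Dickson's lemma, restricted to a finite set of variables for the induction.  For a new variable
  \<open>a\<close>, a set that works for the other variables also works for those monomials whose exponent at
  \<open>a\<close> is at least a bound \<open>M\<close>; each of the finitely many smaller exponents is treated separately.
\<close>

lemma dickson_on:
  assumes "finite (A :: 's set)"
  shows "\<exists>D. finite D \<and> D \<subseteq> S \<and> (\<forall>m\<in>S. \<exists>d\<in>D. \<forall>i\<in>A. expon d i \<le> expon m i)"
  using assms
proof (induct A arbitrary: S)
  case empty
  show ?case
  proof (cases "S = {}")
    case False
    then obtain d where "d \<in> S" by blast
    then show ?thesis by (intro exI[of _ "{d}"]) auto
  qed auto
next
  case (insert a A)
  obtain D where D: "finite D" "D \<subseteq> S" "\<And>m. m \<in> S \<Longrightarrow> \<exists>d\<in>D. \<forall>i\<in>A. expon d i \<le> expon m i"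
    using insert(3)[of S] by blast
  define M where "M = (\<Sum>d\<in>D. expon d a)"
  have "\<forall>k. \<exists>D. finite D \<and> D \<subseteq> {m\<in>S. expon m a = k} \<and>
      (\<forall>m\<in>{m\<in>S. expon m a = k}. \<exists>d\<in>D. \<forall>i\<in>A. expon d i \<le> expon m i)"
    using insert(3) by blast
  from choice[OF this] obtain E where "\<forall>k. finite (E k) \<and> E k \<subseteq> {m\<in>S. expon m a = k} \<and>
      (\<forall>m\<in>{m\<in>S. expon m a = k}. \<exists>d\<in>E k. \<forall>i\<in>A. expon d i \<le> expon m i)"
    by blast
  then have E: "\<And>k. finite (E k)" "\<And>k. E k \<subseteq> {m\<in>S. expon m a = k}"
    "\<And>m k. m \<in> S \<Longrightarrow> expon m a = k \<Longrightarrow> \<exists>d\<in>E k. \<forall>i\<in>A. expon d i \<le> expon m i"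
    by blast+
  have "\<exists>d\<in>D \<union> (\<Union>k<M. E k). \<forall>i\<in>insert a A. expon d i \<le> expon m i" if m: "m \<in> S" for m
  proof (cases "expon m a < M")
    case True
    obtain d where d: "d \<in> E (expon m a)" "\<forall>i\<in>A. expon d i \<le> expon m i" using E(3) m by blast
    moreover have "expon d a = expon m a" using d(1) E(2) by auto
    ultimately show ?thesis using True by (intro bexI[of _ d]) auto
  next
    case False
    obtain d where d: "d \<in> D" "\<forall>i\<in>A. expon d i \<le> expon m i" using D(3) m by blast
    have "expon d a \<le> M" unfolding M_def using d(1) D(1) by (intro member_le_sum) auto
    with d False show ?thesis by (intro bexI[of _ d]) auto
  qed
  moreover have "finite (D \<union> (\<Union>k<M. E k))" using D(1) E(1) by auto
  moreover have "D \<union> (\<Union>k<M. E k) \<subseteq> S" using D(2) E(2) by blast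
  ultimately show ?case by blast
qed

text \<open>
  Hilbert's basis theorem by division: the leading monomials of \<open>I\<close> are multiples of finitely many of
  them, and subtracting a multiple of a corresponding element of \<open>I\<close> lowers the leading monomial.
  Generation is expressed by minimality, the form in which it is transported to the local ring.
\<close>

theorem poly_ideal_finite_basis:
  fixes I :: "'s::finite cpoly set"
  assumes I: "poly_ideal I"
  shows "\<exists>B. finite B \<and> B \<subseteq> I \<and> (\<forall>J. poly_ideal J \<longrightarrow> B \<subseteq> J \<longrightarrow> I \<subseteq> J)"
proof -
  define S where "S = {m. \<exists>f\<in>I. leading f m}"
  obtain D where D: "finite D" "D \<subseteq> S" "\<And>m. m \<in> S \<Longrightarrow> \<exists>d\<in>D. mono_dvd d m"
    using dickson_on[of "UNIV :: 's set" S] by (auto simp: mono_dvd_def)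
  have "\<forall>d\<in>D. \<exists>g. g \<in> I \<and> leading g d" using D(2) by (auto simp: S_def)
  then obtain g where g: "\<And>d. d \<in> D \<Longrightarrow> g d \<in> I" "\<And>d. d \<in> D \<Longrightarrow> leading (g d) d" by metis
  have "I \<subseteq> J" if J: "poly_ideal J" "g ` D \<subseteq> J" for J
  proof -
    have main: "f \<in> J" if "f \<in> I" "leading f m" for f m
      using that
    proof (induct m arbitrary: f rule:
        measure_induct_rule[of "\<lambda>m :: 's \<Rightarrow>\<^sub>0 nat. card {m' :: 's \<Rightarrow>\<^sub>0 nat. mono_key m' < mono_key m}"])
      case (less m)
      have "m \<in> S" using less(2,3) by (auto simp: S_def)
      then obtain d where d: "d \<in> D" "mono_dvd d m" using D(3) by blast
      have m: "m = (m - d) + d" using d(2) by (rule mono_dvd_diff)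
      define q where "q = mon (m - d) * g d"
      have q: "leading q m" unfolding q_def using leading_mono_mult[OF g(2)[OF d(1)], of "m - d"] m by simp
      define c where "c = coef f m / coef q m"
      define f' where "f' = f - poly_const c * q"
      have qI: "q \<in> I" "q \<in> J" unfolding q_def
        using d(1) g(1) J(2) by (auto intro!: poly_idealD(3) I J(1))
      have f': "f' \<in> I" unfolding f'_def using less(2) qI(1) I by (intro poly_idealD(4) poly_idealD(3))
      have f'_less: "mono_key k < mono_key m" if k: "k \<in> supp f'" for k
      proof -
        have "coef f' m = 0" using q
          by (simp add: f'_def lookup_minus coef_const_mult c_def leading_def in_keys_iff)
        then have "k \<noteq> m" using k by (auto simp: in_keys_iff)
        have "k \<in> supp f \<or> k \<in> supp q"
          using k by (auto simp: f'_def lookup_minus coef_const_mult in_keys_iff)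
        then have "mono_key k \<le> mono_key m" using less(3) q by (auto simp: leading_def)
        with \<open>k \<noteq> m\<close> show ?thesis by (simp add: order_le_less)
      qed
      have "f' \<in> J"
      proof (cases "f' = 0")
        case True
        then show ?thesis using J(1) by (simp add: poly_idealD)
      next
        case False
        then obtain k where k: "leading f' k" by (rule ex_leading)
        then have "mono_key k < mono_key m" using f'_less by (simp add: leading_def)
        then have "{m' :: 's \<Rightarrow>\<^sub>0 nat. mono_key m' < mono_key k} \<subset> {m'. mono_key m' < mono_key m}"
          by (auto intro: less_trans)
        then show ?thesis
          using k f' by (intro less(1)) (auto intro: psubset_card_mono finite_mono_key_less)
      qed
      then have "f' + poly_const c * q \<in> J" using qI(2) J(1) by (intro poly_idealD(2,3))
      then show ?case by (simp add: f'_def)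
    qed
    show ?thesis
    proof
      fix f assume "f \<in> I"
      show "f \<in> J"
      proof (cases "f = 0")
        case True then show ?thesis using J(1) by (simp add: poly_idealD)
      next
        case False
        then obtain m where "leading f m" by (rule ex_leading)
        with \<open>f \<in> I\<close> show ?thesis by (rule main)
      qed
    qed
  qed
  then show ?thesis using D(1) g(1) by (intro exI[of _ "g ` D"]) auto
qed

subsection \<open>Counting monomials\<close>

lemma card_deg_eq: "card {m :: 's::finite \<Rightarrow>\<^sub>0 nat. tdeg m = n} = (n + CARD('s) - 1) choose n"
proof -
  obtain xs :: "'s list" where xs: "set xs = UNIV" "distinct xs"
    using finite_distinct_list[of "UNIV :: 's set"] by auto
  then have len: "length xs = CARD('s)" using distinct_card by fastforce
  have tdeg: "tdeg m = sum_list (map (expon m) xs)" for m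
    using xs by (simp add: tdeg_def sum_list_distinct_conv_sum_set)
  have "bij_betw (\<lambda>m. map (expon m) xs) {m. tdeg m = n} {l. length l = CARD('s) \<and> sum_list l = n}"
  proof (rule bij_betw_imageI)
    show "inj_on (\<lambda>m. map (expon m) xs) {m. tdeg m = n}"
      using xs by (auto simp: inj_on_def intro!: poly_mapping_eqI)
    show "(\<lambda>m. map (expon m) xs) ` {m. tdeg m = n} = {l. length l = CARD('s) \<and> sum_list l = n}"
    proof (intro equalityI subsetI)
      fix l assume l: "l \<in> {l. length l = CARD('s) \<and> sum_list l = n}"
      define e where "e x = the (map_of (zip xs l) x)" for x
      have "map e xs = l"
      proof (rule nth_equalityI)
        fix i assume "i < length (map e xs)"
        then show "map e xs ! i = l ! i"
          using l len xs(2) by (simp add: e_def map_of_zip_nth)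
      qed (use l len in auto)
      moreover have "expon (Abs_poly_mapping e) = e" by simp
      ultimately have "map (expon (Abs_poly_mapping e)) xs = l" by simp
      then show "l \<in> (\<lambda>m. map (expon m) xs) ` {m. tdeg m = n}"
        using l by (intro image_eqI[of _ _ "Abs_poly_mapping e"]) (auto simp: tdeg)
    qed (auto simp: len tdeg)
  qed
  then show ?thesis
    by (simp add: bij_betw_same_card card_length_sum_list)
qed

text \<open>
  Homogenising with the missing variable \<open>j\<close> reduces this to the monomials of degree exactly \<open>n\<close>.
\<close>

lemma card_deg_le_avoiding:
  "card {m :: 's::finite \<Rightarrow>\<^sub>0 nat. tdeg m \<le> n \<and> expon m j = 0} = (n + CARD('s) - 1) choose (CARD('s) - 1)"
proof -
  define hom where "hom m = m + Poly_Mapping.single j (n - tdeg m)" for m :: "'s \<Rightarrow>\<^sub>0 nat"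
  define dehom where "dehom m = m - Poly_Mapping.single j (expon m j)" for m :: "'s \<Rightarrow>\<^sub>0 nat"
  have tdeg_single: "tdeg (Poly_Mapping.single j k) = k" for k
  proof -
    have "tdeg (Poly_Mapping.single j k) = (\<Sum>i\<in>UNIV. if i = j then k else 0)"
      unfolding tdeg_def by (rule sum.cong) (auto simp: lookup_single when_def)
    then show ?thesis by simp
  qed
  have dehom: "m = dehom m + Poly_Mapping.single j (expon m j)" "expon (dehom m) j = 0" for m
    unfolding dehom_def
    by (auto simp: lookup_minus lookup_single when_def intro!: expon_le_imp_add)
  have tdeg_dehom: "tdeg m = tdeg (dehom m) + expon m j" for m
    by (metis tdeg_add tdeg_single dehom(1))
  have "bij_betw hom {m. tdeg m \<le> n \<and> expon m j = 0} {m. tdeg m = n}"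
  proof (rule bij_betw_byWitness[where f' = dehom])
    show "\<forall>m\<in>{m. tdeg m \<le> n \<and> expon m j = 0}. dehom (hom m) = m"
      by (auto simp: hom_def dehom_def lookup_add intro!: poly_mapping_eqI)
    show "\<forall>m\<in>{m. tdeg m = n}. hom (dehom m) = m"
    proof
      fix m :: "'s \<Rightarrow>\<^sub>0 nat" assume "m \<in> {m. tdeg m = n}"
      then have "n - tdeg (dehom m) = expon m j" using tdeg_dehom[of m] by simp
      then show "hom (dehom m) = m" unfolding hom_def by (simp flip: dehom(1))
    qed
    show "hom ` {m. tdeg m \<le> n \<and> expon m j = 0} \<subseteq> {m. tdeg m = n}"
      by (auto simp: hom_def tdeg_single)
    show "dehom ` {m. tdeg m = n} \<subseteq> {m. tdeg m \<le> n \<and> expon m j = 0}"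
    proof (intro subsetI, elim imageE)
      fix m m' :: "'s \<Rightarrow>\<^sub>0 nat" assume "m \<in> {m. tdeg m = n}" "m' = dehom m"
      then show "m' \<in> {m. tdeg m \<le> n \<and> expon m j = 0}"
        using tdeg_dehom[of m] dehom(2)[of m] by simp
    qed
  qed
  then have "card {m. tdeg m \<le> n \<and> expon m j = 0} = (n + CARD('s) - 1) choose n"
    by (simp add: bij_betw_same_card card_deg_eq)
  also have "\<dots> = (n + CARD('s) - 1) choose (CARD('s) - 1)"
    by (subst binomial_symmetric) (auto simp: Suc_leI)
  finally show ?thesis .
qed

section \<open>The local ring of a hypersurface at the origin\<close>

lemma trunc_ideal_1: "coef G 0 = 0 \<Longrightarrow> f \<in> trunc_ideal G {} 1 \<longleftrightarrow> coef f 0 = 0"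
proof
  assume "coef f 0 = 0"
  then have "supp f \<subseteq> tail {} 1"
    by (auto simp: tail_def in_keys_iff Suc_le_eq intro: gr0I)
  then show "f \<in> trunc_ideal G {} 1" by (rule trunc_ideal_tail)
qed (auto dest: coef_0_trunc_ideal)

lemma trunc_ideal_product:
  assumes "f \<in> trunc_ideal G {} k" "g \<in> trunc_ideal G {} l"
  shows "f * g \<in> trunc_ideal G {} (k + l)"
proof -
  obtain a b a' b' where f: "f = a * G + b" "supp b \<subseteq> tail {} k"
    and g: "g = a' * G + b'" "supp b' \<subseteq> tail {} l"
    using assms by (auto simp: trunc_ideal_def)
  have "f * g = (a * g + b * a') * G + b * b'"
    unfolding f(1) g(1) by (simp add: algebra_simps)
  moreover have "supp (b * b') \<subseteq> tail {} (k + l)"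
    using f(2) g(2) by (fastforce dest!: supp_mult simp: tail_def intro: add_mono)
  ultimately show ?thesis unfolding trunc_ideal_def by blast
qed

text \<open>
  After normalisation \<open>u = 1 - v\<close> without constant term in \<open>v\<close>, and a truncated geometric series
  inverts \<open>u\<close>.
\<close>

lemma inverse_mod_trunc_ideal:
  assumes u: "coef u 0 \<noteq> 0"
  obtains w where "1 - u * w \<in> trunc_ideal G {} N"
proof -
  define v where "v = 1 - poly_const (1 / coef u 0) * u"
  have v: "supp v \<subseteq> tail {} 1"
  proof
    fix m assume m: "m \<in> supp v"
    have "coef v 0 = 0"
      using u by (simp add: v_def lookup_minus coef_const_mult)
    with m have "m \<noteq> 0" by (auto simp: in_keys_iff)
    then show "m \<in> tail {} 1" by (simp add: tail_def Suc_le_eq)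
  qed
  have pow: "supp (v ^ k) \<subseteq> tail {} k" for k
  proof (induct k)
    case (Suc k)
    then show ?case using v by (fastforce dest!: supp_mult simp: tail_def)
  qed (simp add: tail_def)
  have "u * (poly_const (1 / coef u 0) * (\<Sum>i<N. v ^ i)) = (1 - v) * (\<Sum>i<N. v ^ i)"
    by (simp add: v_def algebra_simps)
  also have "\<dots> = 1 - v ^ N" by (rule one_diff_power_eq[symmetric])
  finally show thesis
    using that[of "poly_const (1 / coef u 0) * (\<Sum>i<N. v ^ i)"] trunc_ideal_tail[OF pow, of N G] by simp
qed

text \<open>
  A saturated ideal that contains \<open>G\<close> is recovered from its extension to the local ring at the origin.
\<close>

definition saturated :: "'s::finite cpoly set \<Rightarrow> bool" where
  "saturated I \<longleftrightarrow> (\<forall>u f. coef u 0 \<noteq> 0 \<longrightarrow> u * f \<in> I \<longrightarrow> f \<in> I)"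

lemma saturated_trunc_ideal: "saturated (trunc_ideal G Y N)"
  unfolding saturated_def
proof (intro allI impI)
  fix u f assume u: "coef u 0 \<noteq> 0" and uf: "u * f \<in> trunc_ideal G Y N"
  obtain w where "1 - u * w \<in> trunc_ideal G {} N" using inverse_mod_trunc_ideal[OF u] .
  then have "1 - u * w \<in> trunc_ideal G Y N" using trunc_ideal_mono[of "{}" Y N N] by auto
  then have "f * (1 - u * w) \<in> trunc_ideal G Y N" by (rule trunc_ideal_mult)
  moreover have "w * (u * f) \<in> trunc_ideal G Y N" using uf by (rule trunc_ideal_mult)
  ultimately have "f * (1 - u * w) + w * (u * f) \<in> trunc_ideal G Y N" by (rule trunc_ideal_add)
  moreover have "f * (1 - u * w) + w * (u * f) = f" by (simp add: algebra_simps)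
  ultimately show "f \<in> trunc_ideal G Y N" by (simp only:)
qed

lemma saturated_local_prime: "saturated (local_prime G Y)"
proof -
  have "f \<in> local_prime G Y" if "coef u 0 \<noteq> 0" "u * f \<in> local_prime G Y" for u f
    using that saturated_trunc_ideal[of G Y] by (auto simp: local_prime_def saturated_def)
  then show ?thesis by (simp add: saturated_def)
qed

lemma (in cring) cring_idealI:
  assumes "I \<subseteq> carrier R" "\<zero> \<in> I" "\<And>x y. x \<in> I \<Longrightarrow> y \<in> I \<Longrightarrow> x \<oplus> y \<in> I"
    "\<And>r x. r \<in> carrier R \<Longrightarrow> x \<in> I \<Longrightarrow> r \<otimes> x \<in> I"
  shows "ideal I R"
proof (rule idealI[OF ring_axioms])
  have neg: "\<ominus> x \<in> I" if "x \<in> I" for x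
    using assms(4)[of "\<ominus> \<one>" x] that assms(1) by (auto simp: l_minus subset_iff)
  show "subgroup I (add_monoid R)"
    by (rule subgroup.intro) (use assms neg in \<open>auto simp: a_inv_def[symmetric]\<close>)
  show "\<And>a x. a \<in> I \<Longrightarrow> x \<in> carrier R \<Longrightarrow> x \<otimes> a \<in> I" by (rule assms)
  show "\<And>a x. a \<in> I \<Longrightarrow> x \<in> carrier R \<Longrightarrow> a \<otimes> x \<in> I"
    using assms(1,4) m_comm by (metis subsetD)
qed

text \<open>
  The universal properties of the localization of the polynomial ring modulo \<open>G\<close> at the origin, free
  of equivalence classes: \<open>\<theta>\<close> is the canonical map, elements outside the ideal of the origin become
  invertible, every element is a fraction, and the kernel consists of what some denominator
  multiplies into \<open>(G)\<close>.
\<close>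

locale hypersurface_germ = cring L for L (structure) +
  fixes \<theta> :: "'s::finite cpoly \<Rightarrow> 'a" and G :: "'s cpoly"
  assumes \<theta>_closed [simp, intro]: "\<theta> f \<in> carrier L"
    and \<theta>_add: "\<theta> (f + g) = \<theta> f \<oplus> \<theta> g"
    and \<theta>_mult: "\<theta> (f * g) = \<theta> f \<otimes> \<theta> g"
    and \<theta>_1: "\<theta> 1 = \<one>"
    and \<theta>_unit: "coef u 0 \<noteq> 0 \<Longrightarrow> \<theta> u \<in> Units L"
    and \<theta>_surj: "x \<in> carrier L \<Longrightarrow> \<exists>f u. coef u 0 \<noteq> 0 \<and> x \<otimes> \<theta> u = \<theta> f"
    and \<theta>_ker: "\<theta> f = \<zero> \<longleftrightarrow> (\<exists>u a. coef u 0 \<noteq> 0 \<and> u * f = a * G)"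
    and G_nonzero: "G \<noteq> 0"
    and G_0: "coef G 0 = 0"
begin

lemma \<theta>_0: "\<theta> 0 = \<zero>"
  unfolding \<theta>_ker by (rule exI[of _ 1], rule exI[of _ 0]) simp

lemma \<theta>_uminus: "\<theta> (- f) = \<ominus> \<theta> f"
proof -
  have "\<theta> (- f) \<oplus> \<theta> f = \<zero>" unfolding \<theta>_add[symmetric] by (simp add: \<theta>_0)
  then show ?thesis by (simp add: minus_equality)
qed

lemma \<theta>_diff: "\<theta> (f - g) = \<theta> f \<ominus> \<theta> g"
  using \<theta>_add[of f "- g"] by (simp add: \<theta>_uminus a_minus_def)

lemma \<theta>_G: "\<theta> G = \<zero>"
  unfolding \<theta>_ker by (rule exI[of _ 1], rule exI[of _ 1]) simp

lemma ideal_unit_mult_iff: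
  assumes "ideal I L" "x \<in> carrier L" "u \<in> Units L"
  shows "x \<otimes> u \<in> I \<longleftrightarrow> x \<in> I"
proof
  assume "x \<otimes> u \<in> I"
  then have "(x \<otimes> u) \<otimes> inv u \<in> I" using assms by (auto intro: ideal.I_r_closed[of I L "x \<otimes> u"])
  moreover have "(x \<otimes> u) \<otimes> inv u = x" using assms by (simp add: m_assoc Units_closed)
  ultimately show "x \<in> I" by (simp only:)
next
  assume "x \<in> I"
  then show "x \<otimes> u \<in> I" using assms by (simp add: ideal.I_r_closed Units_closed)
qed

definition extension :: "'s cpoly set \<Rightarrow> 'a set" where
  "extension I = {x \<in> carrier L. \<exists>u f. coef u 0 \<noteq> 0 \<and> f \<in> I \<and> x \<otimes> \<theta> u = \<theta> f}"

lemma extensionI: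
  "x \<in> carrier L \<Longrightarrow> coef u 0 \<noteq> 0 \<Longrightarrow> f \<in> I \<Longrightarrow> x \<otimes> \<theta> u = \<theta> f \<Longrightarrow> x \<in> extension I"
  unfolding extension_def by blast

lemma \<theta>_in_extension: "f \<in> I \<Longrightarrow> \<theta> f \<in> extension I"
  by (rule extensionI[of _ 1]) (simp_all add: \<theta>_1)

lemma ideal_extension:
  assumes I: "poly_ideal I"
  shows "ideal (extension I) L"
proof (rule cring_idealI)
  show "extension I \<subseteq> carrier L" by (auto simp: extension_def)
  show "\<zero> \<in> extension I" using \<theta>_in_extension[of 0 I] I by (simp add: \<theta>_0 poly_idealD)
next
  fix x y assume "x \<in> extension I" "y \<in> extension I"
  then obtain u f v g where h: "x \<in> carrier L" "coef u 0 \<noteq> 0" "f \<in> I" "x \<otimes> \<theta> u = \<theta> f"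
    "y \<in> carrier L" "coef v 0 \<noteq> 0" "g \<in> I" "y \<otimes> \<theta> v = \<theta> g"
    unfolding extension_def by blast
  show "x \<oplus> y \<in> extension I"
  proof (rule extensionI)
    show "(x \<oplus> y) \<otimes> \<theta> (u * v) = \<theta> (v * f + u * g)"
    proof -
      have "(x \<oplus> y) \<otimes> \<theta> (u * v) = x \<otimes> \<theta> (u * v) \<oplus> y \<otimes> \<theta> (u * v)"
        using h by (simp add: l_distr)
      also have "x \<otimes> \<theta> (u * v) = (x \<otimes> \<theta> u) \<otimes> \<theta> v" using h(1) by (simp add: \<theta>_mult m_assoc)
      also have "y \<otimes> \<theta> (u * v) = (y \<otimes> \<theta> v) \<otimes> \<theta> u" using h(5) by (simp add: \<theta>_mult m_ac)
      finally show ?thesis by (simp add: h \<theta>_mult \<theta>_add m_comm)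
    qed
    show "v * f + u * g \<in> I" using I h by (intro poly_idealD(2,3))
  qed (use h in \<open>simp_all add: coef_mult_0\<close>)
next
  fix r x assume "r \<in> carrier L" "x \<in> extension I"
  then obtain u f v g where h: "x \<in> carrier L" "coef u 0 \<noteq> 0" "f \<in> I" "x \<otimes> \<theta> u = \<theta> f"
    "r \<in> carrier L" "coef v 0 \<noteq> 0" "r \<otimes> \<theta> v = \<theta> g"
    using \<theta>_surj unfolding extension_def by blast
  show "r \<otimes> x \<in> extension I"
  proof (rule extensionI)
    have "(r \<otimes> x) \<otimes> \<theta> (v * u) = (r \<otimes> \<theta> v) \<otimes> (x \<otimes> \<theta> u)"
      using h(1,5) by (simp add: \<theta>_mult m_ac)
    then show "(r \<otimes> x) \<otimes> \<theta> (v * u) = \<theta> (g * f)" by (simp add: h \<theta>_mult)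
    show "g * f \<in> I" using I h by (intro poly_idealD(3))
  qed (use h in \<open>simp_all add: coef_mult_0\<close>)
qed

lemma \<theta>_in_extension_iff:
  assumes I: "poly_ideal I" "saturated I" "G \<in> I"
  shows "\<theta> f \<in> extension I \<longleftrightarrow> f \<in> I"
proof
  assume "\<theta> f \<in> extension I"
  then obtain u g where h: "coef u 0 \<noteq> 0" "g \<in> I" "\<theta> f \<otimes> \<theta> u = \<theta> g"
    unfolding extension_def by blast
  then have "\<theta> (f * u - g) = \<zero>" by (simp add: \<theta>_diff \<theta>_mult r_right_minus_eq)
  then obtain w a where wa: "coef w 0 \<noteq> 0" "w * (f * u - g) = a * G" unfolding \<theta>_ker by blast
  have "a * G + w * g \<in> I" using I h by (intro poly_idealD(2,3))
  moreover have "a * G + w * g = (w * u) * f" unfolding wa(2)[symmetric] by (simp add: algebra_simps)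
  moreover have "coef (w * u) 0 \<noteq> 0" using h wa by (simp add: coef_mult_0)
  ultimately show "f \<in> I" using I(2) unfolding saturated_def by metis
qed (rule \<theta>_in_extension)

lemma fraction_mem_ideal_iff:
  assumes "ideal I L" "x \<in> carrier L" "coef u 0 \<noteq> 0" "x \<otimes> \<theta> u = \<theta> f"
  shows "x \<in> I \<longleftrightarrow> \<theta> f \<in> I"
  using ideal_unit_mult_iff[OF assms(1,2) \<theta>_unit[OF assms(3)]] assms(4) by simp

lemma fraction_mem_extension_iff:
  assumes I: "poly_ideal I" "saturated I" "G \<in> I"
    and x: "x \<in> carrier L" "coef u 0 \<noteq> 0" "x \<otimes> \<theta> u = \<theta> f"
  shows "x \<in> extension I \<longleftrightarrow> f \<in> I"
  using fraction_mem_ideal_iff[OF ideal_extension[OF I(1)] x] \<theta>_in_extension_iff[OF I] by simp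

definition contraction :: "'a set \<Rightarrow> 's cpoly set" where
  "contraction J = {f. \<theta> f \<in> J}"

lemma poly_ideal_contraction:
  assumes "ideal J L" shows "poly_ideal (contraction J)"
  using assms unfolding poly_ideal_def contraction_def
  by (auto simp: \<theta>_0 \<theta>_add \<theta>_mult additive_subgroup.zero_closed additive_subgroup.a_closed
      ideal.axioms(1) intro!: ideal.I_l_closed)

lemma contraction_subset_imp_subset:
  assumes "ideal I L" "ideal J L" "contraction I \<subseteq> contraction J"
  shows "I \<subseteq> J"
proof
  fix x assume x: "x \<in> I"
  then have xc: "x \<in> carrier L" using assms(1) by (rule ideal.Icarr[rotated])
  then obtain f u where "coef u 0 \<noteq> 0" "x \<otimes> \<theta> u = \<theta> f" using \<theta>_surj by blast
  then show "x \<in> J"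
    using fraction_mem_ideal_iff[OF _ xc] assms x unfolding contraction_def by blast
qed

lemma poly_prime_contraction:
  assumes "primeideal P L" shows "poly_prime (contraction P)"
proof -
  interpret P: primeideal P L by fact
  have "\<one> \<notin> P" using P.one_imp_carrier P.I_notcarr by blast
  moreover have "f * g \<in> contraction P \<Longrightarrow> f \<in> contraction P \<or> g \<in> contraction P" for f g
    using P.I_prime[of "\<theta> f" "\<theta> g"] by (simp add: contraction_def \<theta>_mult)
  ultimately show ?thesis
    unfolding poly_prime_def using poly_ideal_contraction[OF P.is_ideal]
    by (auto simp: contraction_def \<theta>_1)
qed

lemma primeideal_extension:
  assumes Q: "poly_prime Q" "saturated Q" "G \<in> Q"
  shows "primeideal (extension Q) L"
proof (rule primeidealI)
  have I: "poly_ideal Q" using Q(1) by (simp add: poly_prime_def)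
  show "ideal (extension Q) L" using I by (rule ideal_extension)
  show "cring L" by (rule is_cring)
  have "\<theta> 1 \<notin> extension Q" using Q I by (simp add: \<theta>_in_extension_iff poly_prime_def)
  then show "carrier L \<noteq> extension Q" using \<theta>_closed by blast
  fix a b assume ab: "a \<in> carrier L" "b \<in> carrier L" "a \<otimes> b \<in> extension Q"
  then obtain f u g v where h: "coef u 0 \<noteq> 0" "a \<otimes> \<theta> u = \<theta> f" "coef v 0 \<noteq> 0" "b \<otimes> \<theta> v = \<theta> g"
    using \<theta>_surj by meson
  have "(a \<otimes> b) \<otimes> \<theta> (u * v) = (a \<otimes> \<theta> u) \<otimes> (b \<otimes> \<theta> v)" using ab by (simp add: \<theta>_mult m_ac)
  then have "(a \<otimes> b) \<otimes> \<theta> (u * v) = \<theta> (f * g)" by (simp add: h \<theta>_mult)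
  then have "f * g \<in> Q"
    using ab h fraction_mem_extension_iff[OF I Q(2,3), of "a \<otimes> b" "u * v"] by (simp add: coef_mult_0)
  then have "f \<in> Q \<or> g \<in> Q" using Q(1) by (simp add: poly_prime_def)
  then show "a \<in> extension Q \<or> b \<in> extension Q"
    using ab h fraction_mem_extension_iff[OF I Q(2,3)] by blast
qed

lemma extension_strict_mono:
  assumes "poly_ideal I" "saturated I" "G \<in> I" "poly_ideal J" "saturated J" "G \<in> J" "I \<subset> J"
  shows "extension I \<subset> extension J"
proof
  show "extension I \<subseteq> extension J" using assms(7) unfolding extension_def by blast
  obtain f where f: "f \<in> J" "f \<notin> I" using assms(7) by blast
  then show "extension I \<noteq> extension J" using \<theta>_in_extension_iff assms by blast
qed

subsection \<open>Krull dimension\<close>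

text \<open>
  The contracted chain starts with a prime that contains \<open>G \<noteq> 0\<close>, so the zero ideal can be put in
  front of it.  This accounts for the 1 that is subtracted from the number of variables.
\<close>

lemma krull_dim_le: "krull_dim L \<le> enat (CARD('s) - 1)"
  unfolding krull_dim_def
proof (rule SUP_least)
  fix k assume "k \<in> {k. \<exists>P :: nat \<Rightarrow> 'a set. (\<forall>i\<le>k. primeideal (P i) L) \<and> (\<forall>i<k. P i \<subset> P (Suc i))}"
  then obtain P :: "nat \<Rightarrow> 'a set" where P: "\<And>i. i \<le> k \<Longrightarrow> primeideal (P i) L"
    "\<And>i. i < k \<Longrightarrow> P i \<subset> P (Suc i)" by blast
  define Q where "Q i = (case i of 0 \<Rightarrow> {0} | Suc i \<Rightarrow> contraction (P i))" for i
  have "Suc k \<le> CARD('s)"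
  proof (rule poly_prime_chain_length)
    fix i assume "i \<le> Suc k"
    then show "poly_prime (Q i)"
      using P(1) by (auto simp: Q_def poly_prime_0 poly_prime_contraction split: nat.split)
  next
    fix i assume i: "i < Suc k"
    show "Q i \<subset> Q (Suc i)"
    proof (cases i)
      case 0
      have P0: "ideal (P 0) L" using P(1)[of 0] by (simp add: primeideal.axioms)
      then have "G \<in> contraction (P 0)" "0 \<in> contraction (P 0)"
        by (auto simp: contraction_def \<theta>_G \<theta>_0 additive_subgroup.zero_closed ideal.axioms(1))
      then show ?thesis using G_nonzero by (auto simp: Q_def 0)
    next
      case (Suc l)
      then have l: "ideal (P l) L" "ideal (P (Suc l)) L" "P l \<subset> P (Suc l)"
        using i P by (auto simp: primeideal.axioms)
      then have "contraction (P l) \<subseteq> contraction (P (Suc l))" by (auto simp: contraction_def)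
      moreover have "\<not> contraction (P (Suc l)) \<subseteq> contraction (P l)"
        using contraction_subset_imp_subset[OF l(2,1)] l(3) by blast
      ultimately show ?thesis by (auto simp: Q_def Suc)
    qed
  qed
  then show "enat k \<le> enat (CARD('s) - 1)" by simp
qed

text \<open>
  The variables other than \<open>j\<close> are adjoined one at a time.
\<close>

lemma krull_dim_ge:
  assumes G: "initial G (unit_expon j)"
  shows "enat (CARD('s) - 1) \<le> krull_dim L"
proof -
  obtain vs where vs: "set vs = UNIV - {j}" "distinct vs"
    using finite_distinct_list[of "UNIV - {j}"] by auto
  have len: "length vs = CARD('s) - 1"
    using vs by (metis card_Diff_singleton distinct_card UNIV_I)
  define Q where "Q i = local_prime G (set (take i vs))" for i
  have j: "j \<notin> set (take i vs)" for i using vs(1) set_take_subset[of i vs] by auto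
  have Q: "poly_prime (Q i)" "saturated (Q i)" "G \<in> Q i" for i
    unfolding Q_def by (auto intro: poly_prime_local_prime[OF G j] saturated_local_prime local_prime_gen)
  have Q_ideal: "poly_ideal (Q i)" for i using Q(1) by (simp add: poly_prime_def)
  have Q_mono: "Q i \<subset> Q (Suc i)" if "i < length vs" for i
  proof -
    have take: "set (take (Suc i) vs) = insert (vs ! i) (set (take i vs))"
      using that by (simp add: take_Suc_conv_app_nth)
    have "vs ! i \<notin> set (take i vs)"
      using that vs(2) by (auto simp: in_set_conv_nth nth_eq_iff_index_eq)
    then show ?thesis
      unfolding Q_def take using j[of "Suc i"] by (intro local_prime_strict_mono[OF G]) (simp_all add: take)
  qed
  have "\<exists>P :: nat \<Rightarrow> 'a set. (\<forall>i\<le>length vs. primeideal (P i) L) \<and> (\<forall>i<length vs. P i \<subset> P (Suc i))"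
    by (rule exI[of _ "\<lambda>i. extension (Q i)"])
      (auto intro: primeideal_extension Q simp: extension_strict_mono Q Q_ideal Q_mono)
  then show ?thesis unfolding krull_dim_def len[symmetric] by (intro SUP_upper) simp
qed

subsection \<open>The maximal ideal and its powers\<close>

definition max_ideal :: "'a set" where
  "max_ideal = extension (trunc_ideal G {} 1)"

lemma G_in_trunc_ideal: "G \<in> trunc_ideal G Y N"
  using trunc_ideal_gen[of 1] by simp

lemma \<theta>_in_trunc_extension_iff: "\<theta> f \<in> extension (trunc_ideal G Y N) \<longleftrightarrow> f \<in> trunc_ideal G Y N"
  by (rule \<theta>_in_extension_iff[OF poly_ideal_trunc_ideal saturated_trunc_ideal G_in_trunc_ideal])

lemma \<theta>_in_max_ideal_iff: "\<theta> f \<in> max_ideal \<longleftrightarrow> coef f 0 = 0"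
  unfolding max_ideal_def by (simp add: \<theta>_in_trunc_extension_iff trunc_ideal_1 G_0 del: One_nat_def)

lemma ideal_max_ideal: "ideal max_ideal L"
  unfolding max_ideal_def by (rule ideal_extension[OF poly_ideal_trunc_ideal])

lemma fraction_mem_max_ideal_iff:
  assumes "x \<in> carrier L" "coef u 0 \<noteq> 0" "x \<otimes> \<theta> u = \<theta> f"
  shows "x \<in> max_ideal \<longleftrightarrow> coef f 0 = 0"
  using fraction_mem_ideal_iff[OF ideal_max_ideal assms] by (simp add: \<theta>_in_max_ideal_iff)

lemma unit_if_notin_max_ideal:
  assumes "x \<in> carrier L" "x \<notin> max_ideal" shows "x \<in> Units L"
proof -
  obtain f u where h: "coef u 0 \<noteq> 0" "x \<otimes> \<theta> u = \<theta> f" using assms(1) \<theta>_surj by blast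
  then have "\<theta> f \<in> Units L" using fraction_mem_max_ideal_iff[OF assms(1)] assms(2) \<theta>_unit by blast
  then show ?thesis using prod_unit_r[of x "\<theta> u"] h assms \<theta>_unit by simp
qed

lemma ideal_subset_max_ideal:
  assumes J: "ideal J L" "J \<noteq> carrier L" shows "J \<subseteq> max_ideal"
proof
  fix x assume x: "x \<in> J"
  then have xc: "x \<in> carrier L" using J(1) by (rule ideal.Icarr[rotated])
  show "x \<in> max_ideal"
  proof (rule ccontr)
    assume "x \<notin> max_ideal"
    then have "x \<in> Units L" using xc by (rule unit_if_notin_max_ideal[rotated])
    then have "\<one> \<in> J" using ideal_unit_mult_iff[OF J(1), of \<one> x] x by (simp add: Units_closed)
    with J show False using ideal.one_imp_carrier by blast
  qed
qed

lemma max_ideal_proper: "max_ideal \<noteq> carrier L"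
  using \<theta>_in_max_ideal_iff[of 1] \<theta>_closed[of 1] by auto

lemma maximalideal_iff: "maximalideal M L \<longleftrightarrow> M = max_ideal"
proof
  assume "M = max_ideal"
  moreover have "maximalideal max_ideal L"
    using ideal_max_ideal max_ideal_proper ideal_subset_max_ideal by (intro maximalidealI) blast+
  ultimately show "maximalideal M L" by simp
next
  assume M: "maximalideal M L"
  then interpret M: maximalideal M L .
  show "M = max_ideal"
    using M.I_maximal[OF ideal_max_ideal] ideal_subset_max_ideal[OF M.is_ideal] M.I_notcarr
      max_ideal_proper ideal.Icarr[OF ideal_max_ideal] by blast
qed

lemma local_ring: "local_ring L"
  unfolding local_ring_def using is_cring maximalideal_iff by auto

lemma noetherian: "noetherian_ring L"
proof (rule noetherian_ringI)
  fix I assume I: "ideal I L"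
  obtain B where B: "finite B" "B \<subseteq> contraction I"
    "\<And>J. poly_ideal J \<Longrightarrow> B \<subseteq> J \<Longrightarrow> contraction I \<subseteq> J"
    using poly_ideal_finite_basis[OF poly_ideal_contraction[OF I]] by blast
  have sub: "\<theta> ` B \<subseteq> carrier L" by blast
  have id: "ideal (Idl (\<theta> ` B)) L" using sub by (rule genideal_ideal)
  have "B \<subseteq> contraction (Idl (\<theta> ` B))"
    using genideal_self[OF sub] by (auto simp: contraction_def)
  then have "contraction I \<subseteq> contraction (Idl (\<theta> ` B))"
    using B(3) poly_ideal_contraction[OF id] by blast
  then have "I \<subseteq> Idl (\<theta> ` B)" by (rule contraction_subset_imp_subset[OF I id])
  moreover have "Idl (\<theta> ` B) \<subseteq> I"
    using B(2) by (intro genideal_minimal I) (auto simp: contraction_def)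
  ultimately show "\<exists>A\<subseteq>carrier L. finite A \<and> I = Idl A" using B(1) sub by blast
qed

text \<open>
  A monomial of degree \<open>k + 1\<close> is a monomial of degree \<open>k\<close> times a variable.
\<close>

lemma max_ideal_pow: "max_ideal [^]\<^bsub>ideals_set L\<^esub> k = extension (trunc_ideal G {} k)"
proof (induct k)
  case 0
  have "trunc_ideal G {} 0 = UNIV"
    using trunc_ideal_tail[of _ "{}" 0 G] by (auto simp: tail_def)
  moreover have "extension UNIV = carrier L" using \<theta>_surj by (auto simp: extension_def)
  ultimately show ?case by (simp add: ideals_set_def)
next
  case (Suc k)
  let ?T = "\<lambda>k. trunc_ideal G {} k"
  have id: "ideal (extension (?T k)) L" for k by (rule ideal_extension[OF poly_ideal_trunc_ideal])
  have prod_id: "ideal (extension (?T k) \<cdot> max_ideal) L"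
    by (rule ideal_prod_is_ideal[OF id ideal_max_ideal])
  have "extension (?T k) \<cdot> max_ideal = extension (?T (Suc k))"
  proof
    show "extension (?T k) \<cdot> max_ideal \<subseteq> extension (?T (Suc k))"
    proof
      fix x assume "x \<in> extension (?T k) \<cdot> max_ideal"
      then show "x \<in> extension (?T (Suc k))"
      proof induct
        case (prod x y)
        then obtain u f v g where h: "x \<in> carrier L" "coef u 0 \<noteq> 0" "f \<in> ?T k" "x \<otimes> \<theta> u = \<theta> f"
          "y \<in> carrier L" "coef v 0 \<noteq> 0" "g \<in> ?T 1" "y \<otimes> \<theta> v = \<theta> g"
          unfolding extension_def max_ideal_def by blast
        have "(x \<otimes> y) \<otimes> \<theta> (u * v) = (x \<otimes> \<theta> u) \<otimes> (y \<otimes> \<theta> v)" using h(1,5) by (simp add: \<theta>_mult m_ac)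
        then have "(x \<otimes> y) \<otimes> \<theta> (u * v) = \<theta> (f * g)" by (simp add: h \<theta>_mult)
        moreover have "f * g \<in> ?T (Suc k)" using trunc_ideal_product[OF h(3,7)] by simp
        ultimately show ?case using h by (intro extensionI[of _ "u * v"]) (simp_all add: coef_mult_0)
      next
        case (sum x y)
        then show ?case using id by (simp add: additive_subgroup.a_closed ideal.axioms(1))
      qed
    qed
    show "extension (?T (Suc k)) \<subseteq> extension (?T k) \<cdot> max_ideal"
    proof (rule contraction_subset_imp_subset[OF id prod_id], rule subsetI)
      fix f assume "f \<in> contraction (extension (?T (Suc k)))"
      then have "f \<in> ?T (Suc k)" by (simp add: contraction_def \<theta>_in_trunc_extension_iff)
      then obtain a b where f: "f = a * G + b" and b: "supp b \<subseteq> tail {} (Suc k)"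
        by (auto simp: trunc_ideal_def)
      note C = poly_ideal_contraction[OF prod_id]
      have "(\<Sum>m\<in>supp b. Poly_Mapping.single m (coef b m)) \<in> contraction (extension (?T k) \<cdot> max_ideal)"
      proof (rule poly_ideal_sum[OF C])
        fix m assume "m \<in> supp b"
        then have tdeg: "Suc k \<le> tdeg m" using b by (auto simp: tail_def)
        then have "m \<noteq> 0" by auto
        then obtain v where v: "0 < expon m v" using ex_expon_pos by blast
        have m: "m = (m - unit_expon v) + unit_expon v" using v by (rule divide_var)
        then have "tdeg m = tdeg (m - unit_expon v) + 1" by (metis tdeg_add tdeg_unit_expon)
        with tdeg have "Poly_Mapping.single (m - unit_expon v) (coef b m) \<in> ?T k"
          by (intro trunc_ideal_tail) (auto simp: tail_def split: if_splits)
        then have "\<theta> (Poly_Mapping.single (m - unit_expon v) (coef b m)) \<otimes> \<theta> (pvar v)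
            \<in> extension (?T k) \<cdot> max_ideal"
          by (intro ideal_prod.prod) (simp_all add: \<theta>_in_max_ideal_iff \<theta>_in_extension coef_pvar_0)
        then show "Poly_Mapping.single m (coef b m) \<in> contraction (extension (?T k) \<cdot> max_ideal)"
          by (simp add: contraction_def mult_single flip: \<theta>_mult m)
      qed
      then have "b \<in> contraction (extension (?T k) \<cdot> max_ideal)" by (simp flip: cpoly_sum_monos)
      moreover have "a * G \<in> contraction (extension (?T k) \<cdot> max_ideal)"
        using prod_id by (simp add: contraction_def \<theta>_mult \<theta>_G additive_subgroup.zero_closed ideal.axioms(1))
      ultimately show "f \<in> contraction (extension (?T k) \<cdot> max_ideal)"
        unfolding f by (intro poly_idealD(2)[OF C])
    qed
  qed
  then show ?case using Suc by (simp add: ideals_set_def nat_pow_def)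
qed

end

text \<open>
  A spanning list bounds the dimension; it is used to compare generators of the maximal ideal with
  the dimension of its quotient by the square.
\<close>

lemma (in ring) Span_dimension_le_length:
  assumes "subfield K R" "set Us \<subseteq> carrier R"
  shows "\<exists>d\<le>length Us. dimension d K (Span K Us)"
  using assms(2)
proof (induct Us)
  case Nil
  then show ?case by auto
next
  case (Cons u Us)
  then obtain d where d: "d \<le> length Us" "dimension d K (Span K Us)" by auto
  show ?case
  proof (cases "u \<in> Span K Us")
    case True
    have "set (u # Us) \<subseteq> Span K Us"
      using True Span_base_incl[OF assms(1), of Us] Cons(2) by simp
    then have "Span K (u # Us) = Span K Us"
      using Cons(2) mono_Span_subset[OF assms(1), of "u # Us" Us] mono_Span[OF assms(1), of Us u] by auto
    with d show ?thesis by (intro exI[of _ d]) simp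
  next
    case False
    then have "dimension (Suc d) K (line_extension K u (Span K Us))"
      using d Cons(2) by (intro Suc_dim) auto
    with d show ?thesis by (intro exI[of _ "Suc d"]) simp
  qed
qed

lemma standard_unit_expon: "standard (unit_expon j) {} (Suc n) = {m. tdeg m \<le> n \<and> expon m j = 0}"
  by (auto simp: standard_def tail_def mono_dvd_def lookup_single when_def)

context hypersurface_germ
begin

subsection \<open>The quotients by the powers of the maximal ideal\<close>

definition jet :: "nat \<Rightarrow> 's cpoly \<Rightarrow> 'a set" where
  "jet k f = extension (trunc_ideal G {} k) +> \<theta> f"

abbreviation jet_ring :: "nat \<Rightarrow> 'a set ring" where
  "jet_ring k \<equiv> L Quot (extension (trunc_ideal G {} k))"

abbreviation constants :: "nat \<Rightarrow> 'a set set" where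
  "constants k \<equiv> range (\<lambda>c. jet k (poly_const c))"

lemma ideal_ext_trunc: "ideal (extension (trunc_ideal G {} k)) L"
  by (rule ideal_extension[OF poly_ideal_trunc_ideal])

lemma cring_jet_ring: "cring (jet_ring k)"
  by (rule ideal.quotient_is_cring[OF ideal_ext_trunc is_cring])

lemma coset_hom:
  shows "x \<in> carrier L \<Longrightarrow> extension (trunc_ideal G {} k) +> x \<in> carrier (jet_ring k)"
    and "x \<in> carrier L \<Longrightarrow> y \<in> carrier L \<Longrightarrow> extension (trunc_ideal G {} k) +> (x \<oplus> y) =
      (extension (trunc_ideal G {} k) +> x) \<oplus>\<^bsub>jet_ring k\<^esub> (extension (trunc_ideal G {} k) +> y)"
    and "x \<in> carrier L \<Longrightarrow> y \<in> carrier L \<Longrightarrow> extension (trunc_ideal G {} k) +> (x \<otimes> y) =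
      (extension (trunc_ideal G {} k) +> x) \<otimes>\<^bsub>jet_ring k\<^esub> (extension (trunc_ideal G {} k) +> y)"
    and "extension (trunc_ideal G {} k) +> \<one> = \<one>\<^bsub>jet_ring k\<^esub>"
  using ideal.rcos_ring_hom[OF ideal_ext_trunc, of k] by (auto simp: ring_hom_def)

lemma jet_closed: "jet k f \<in> carrier (jet_ring k)"
  and jet_add: "jet k (f + g) = jet k f \<oplus>\<^bsub>jet_ring k\<^esub> jet k g"
  and jet_mult: "jet k (f * g) = jet k f \<otimes>\<^bsub>jet_ring k\<^esub> jet k g"
  and jet_1: "jet k 1 = \<one>\<^bsub>jet_ring k\<^esub>"
  unfolding jet_def by (simp_all add: coset_hom \<theta>_add \<theta>_mult \<theta>_1)

lemma coset_eq_iff: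
  assumes "x \<in> carrier L" "y \<in> carrier L"
  shows "extension (trunc_ideal G {} k) +> x = extension (trunc_ideal G {} k) +> y \<longleftrightarrow>
    x \<ominus> y \<in> extension (trunc_ideal G {} k)"
  using quotient_eq_iff_same_a_r_cos[OF ideal_ext_trunc assms] by blast

lemma jet_eq_iff: "jet k f = jet k g \<longleftrightarrow> f - g \<in> trunc_ideal G {} k"
  unfolding jet_def by (simp add: coset_eq_iff \<theta>_in_trunc_extension_iff flip: \<theta>_diff)

lemma jet_0: "jet k 0 = \<zero>\<^bsub>jet_ring k\<^esub>"
proof -
  interpret J: cring "jet_ring k" by (rule cring_jet_ring)
  have "jet k 0 \<oplus>\<^bsub>jet_ring k\<^esub> jet k 0 = jet k 0" by (simp flip: jet_add)
  then show ?thesis using jet_closed[of k 0] by (metis J.add.l_cancel_one)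
qed

text \<open>
  Every germ agrees with a polynomial to any given order, because denominators are invertible
  modulo the powers of the maximal ideal.
\<close>

lemma coset_eq_jet:
  assumes x: "x \<in> carrier L"
  obtains f where "extension (trunc_ideal G {} k) +> x = jet k f"
proof -
  obtain f u where h: "coef u 0 \<noteq> 0" "x \<otimes> \<theta> u = \<theta> f" using \<theta>_surj x by blast
  obtain w where w: "1 - u * w \<in> trunc_ideal G {} k" using inverse_mod_trunc_ideal[OF h(1)] .
  have "x \<otimes> \<theta> (1 - u * w) \<in> extension (trunc_ideal G {} k)"
    using x w by (intro ideal.I_l_closed[OF ideal_ext_trunc]) (simp_all add: \<theta>_in_extension)
  also have "x \<otimes> \<theta> (1 - u * w) = x \<ominus> (x \<otimes> \<theta> u) \<otimes> \<theta> w"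
    using x by (simp add: \<theta>_diff \<theta>_mult \<theta>_1 a_minus_def r_distr r_minus m_assoc)
  also have "\<dots> = x \<ominus> \<theta> (f * w)" by (simp add: h \<theta>_mult)
  finally have "extension (trunc_ideal G {} k) +> x = jet k (f * w)"
    unfolding jet_def using x by (simp add: coset_eq_iff)
  then show thesis by (rule that)
qed

lemma subfield_constants:
  assumes "k \<ge> 1" shows "subfield (constants k) (jet_ring k)"
proof -
  let ?C = "ring_of_type_algebra :: complex ring"
  have C: "field ?C" by (rule field_from_type_algebra)
  interpret J: cring "jet_ring k" by (rule cring_jet_ring)
  have hom: "ring_hom_ring ?C (jet_ring k) (\<lambda>c. jet k (poly_const c))"
  proof (rule ring_hom_ringI2)
    show "ring ?C" by (rule ring_from_type_algebra)
    show "ring (jet_ring k)" by (rule J.ring_axioms)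
    show "(\<lambda>c. jet k (poly_const c)) \<in> ring_hom ?C (jet_ring k)"
    proof (rule ring_hom_memI)
      fix x y :: complex
      have "poly_const (x * y) = (poly_const x * poly_const y :: 's cpoly)" by (simp add: mult_single)
      then show "jet k (poly_const (x \<otimes>\<^bsub>?C\<^esub> y)) =
          jet k (poly_const x) \<otimes>\<^bsub>jet_ring k\<^esub> jet k (poly_const y)"
        by (simp add: ring_of_type_algebra_def jet_mult)
      show "jet k (poly_const (x \<oplus>\<^bsub>?C\<^esub> y)) =
          jet k (poly_const x) \<oplus>\<^bsub>jet_ring k\<^esub> jet k (poly_const y)"
        by (simp add: ring_of_type_algebra_def single_add jet_add)
    qed (simp_all add: jet_closed ring_of_type_algebra_def jet_1)
  qed
  have "jet k 1 \<noteq> jet k 0"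
    using coef_0_trunc_ideal[OF _ G_0 assms, of 1] by (auto simp: jet_eq_iff)
  then have "\<one>\<^bsub>jet_ring k\<^esub> \<noteq> \<zero>\<^bsub>jet_ring k\<^esub>" by (simp add: jet_1 jet_0)
  from ring_hom_ring.img_is_subfield(2)[OF hom field.carrier_is_subfield[OF C] this]
  show ?thesis by (simp add: ring_of_type_algebra_def)
qed

text \<open>
  The standard monomials are adjoined one at a time; linear independence says that each of them
  enlarges the space.
\<close>

lemma dimension_standard:
  assumes G: "initial G \<alpha>" and S: "finite S" "S \<subseteq> standard \<alpha> {} k"
  shows "ring.dimension (jet_ring k) (card S) (constants k) {jet k h | h. supp h \<subseteq> S}"
proof -
  interpret J: cring "jet_ring k" by (rule cring_jet_ring)
  show ?thesis using S
  proof (induct S rule: finite_induct)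
    case empty
    have "{jet k h | h. supp h \<subseteq> {}} = {\<zero>\<^bsub>jet_ring k\<^esub>}" by (auto simp: jet_0)
    then show ?case by simp
  next
    case (insert m S)
    have "jet k (mon m) \<notin> {jet k h | h. supp h \<subseteq> S}"
    proof
      assume "jet k (mon m) \<in> {jet k h | h. supp h \<subseteq> S}"
      then obtain h where h: "supp h \<subseteq> S" "mon m - h \<in> trunc_ideal G {} k" by (auto simp: jet_eq_iff)
      moreover have "supp (mon m - h) \<subseteq> standard \<alpha> {} k"
        using h(1) insert by (intro supp_diff_subset) auto
      ultimately have "mon m - h = 0" by (intro standard_independent[OF G]) auto
      then have "m \<in> supp h" by (metis eq_iff_diff_eq_0 in_keys_iff lookup_single_eq zero_neq_one)
      with h(1) insert(2) show False by blast
    qed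
    moreover have "J.line_extension (constants k) (jet k (mon m)) {jet k h | h. supp h \<subseteq> S} =
        {jet k h | h. supp h \<subseteq> insert m S}" (is "?A = ?B")
    proof (intro equalityI subsetI)
      fix x assume "x \<in> ?A"
      then obtain c h where x: "supp h \<subseteq> S"
        "x = jet k (poly_const c) \<otimes>\<^bsub>jet_ring k\<^esub> jet k (mon m) \<oplus>\<^bsub>jet_ring k\<^esub> jet k h"
        unfolding J.line_extension_mem_iff by auto
      have "x = jet k (poly_const c * mon m + h)" by (simp add: x jet_add jet_mult)
      moreover have "supp (poly_const c * mon m + h) \<subseteq> insert m S"
        using x(1) by (intro supp_add_subset) (auto simp: mult_single split: if_splits)
      ultimately show "x \<in> ?B" by blast
    next
      fix x assume "x \<in> ?B"
      then obtain h where h: "x = jet k h" "supp h \<subseteq> insert m S" by blast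
      have "h = poly_const (coef h m) * mon m + (h - Poly_Mapping.single m (coef h m))"
        by (simp add: mult_single)
      then have "x = jet k (poly_const (coef h m)) \<otimes>\<^bsub>jet_ring k\<^esub> jet k (mon m) \<oplus>\<^bsub>jet_ring k\<^esub>
          jet k (h - Poly_Mapping.single m (coef h m))"
        unfolding h(1) by (metis jet_add jet_mult)
      moreover have "supp (h - Poly_Mapping.single m (coef h m)) \<subseteq> S"
        using h(2) by (auto simp: in_keys_iff lookup_minus lookup_single when_def subset_iff)
      ultimately show "x \<in> ?A" unfolding J.line_extension_mem_iff by blast
    qed
    ultimately show ?case
      using J.Suc_dim[of "jet k (mon m)" "{jet k h | h. supp h \<subseteq> S}" "card S" "constants k"] insert jet_closed
      by simp
  qed
qed

lemma max_ideal_cosets: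
  assumes G: "initial G \<alpha>" and k: "k \<ge> 1"
  shows "(\<lambda>x. extension (trunc_ideal G {} k) +> x) ` max_ideal =
    {jet k h | h. supp h \<subseteq> standard \<alpha> {} k - {0}}"
proof (intro equalityI subsetI)
  fix C assume "C \<in> (\<lambda>x. extension (trunc_ideal G {} k) +> x) ` max_ideal"
  then obtain x where x: "x \<in> max_ideal" "C = extension (trunc_ideal G {} k) +> x" by blast
  have xc: "x \<in> carrier L" using x(1) ideal_max_ideal by (rule ideal.Icarr[rotated])
  obtain f where f: "C = jet k f" using coset_eq_jet[OF xc] x(2) by metis
  obtain h where h: "supp h \<subseteq> standard \<alpha> {} k" "f - h \<in> trunc_ideal G {} k"
    using standard_span[OF G] by blast
  then have Ch: "C = jet k h" using f jet_eq_iff by simp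
  have "extension (trunc_ideal G {} k) \<subseteq> max_ideal"
    using trunc_ideal_mono[of "{}" "{}" 1 k G] k unfolding max_ideal_def extension_def by blast
  moreover have "x \<ominus> \<theta> h \<in> extension (trunc_ideal G {} k)"
    using Ch xc by (simp add: x(2) jet_def coset_eq_iff)
  ultimately have "x \<ominus> \<theta> h \<in> max_ideal" by blast
  then have "x \<ominus> (x \<ominus> \<theta> h) \<in> max_ideal"
    using x(1) ideal_max_ideal by (metis a_minus_def additive_subgroup.a_closed additive_subgroup.a_inv_closed ideal.axioms(1))
  moreover have "x \<ominus> (x \<ominus> \<theta> h) = \<theta> h"
    using xc by (simp add: a_minus_def minus_add r_neg2)
  ultimately have "coef h 0 = 0" by (simp add: \<theta>_in_max_ideal_iff)
  then have "supp h \<subseteq> standard \<alpha> {} k - {0}" using h(1) by (auto simp: in_keys_iff)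
  with Ch show "C \<in> {jet k h | h. supp h \<subseteq> standard \<alpha> {} k - {0}}" by blast
next
  fix C assume "C \<in> {jet k h | h. supp h \<subseteq> standard \<alpha> {} k - {0}}"
  then obtain h where h: "C = jet k h" "supp h \<subseteq> standard \<alpha> {} k - {0}" by blast
  then have "coef h 0 = 0" by (auto simp: in_keys_iff)
  then show "C \<in> (\<lambda>x. extension (trunc_ideal G {} k) +> x) ` max_ideal"
    unfolding h(1) jet_def by (simp add: \<theta>_in_max_ideal_iff)
qed

theorem max_ideal_quotient_dimension_iff:
  assumes G: "initial G \<alpha>" and k: "k \<ge> 1"
  shows "ring.dimension (jet_ring k) d (constants k)
      ((\<lambda>x. extension (trunc_ideal G {} k) +> x) ` max_ideal) \<longleftrightarrow> d = card (standard \<alpha> {} k - {0})"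
proof -
  interpret J: cring "jet_ring k" by (rule cring_jet_ring)
  have "J.dimension (card (standard \<alpha> {} k - {0})) (constants k)
      ((\<lambda>x. extension (trunc_ideal G {} k) +> x) ` max_ideal)"
    unfolding max_ideal_cosets[OF G k]
    by (rule dimension_standard[OF G]) (auto simp: finite_standard)
  then show ?thesis using J.dimension_is_inj[OF subfield_constants[OF k]] by blast
qed

subsection \<open>Generators of the maximal ideal\<close>

text \<open>
  The easy half of Nakayama's lemma: generators of the maximal ideal span it modulo its square over the
  constants, because a coefficient matters only through its constant term.
\<close>

lemma card_generators_ge:
  assumes G: "initial G \<alpha>" and A: "finite A" "A \<subseteq> carrier L" "Idl A = max_ideal"
  shows "card (standard \<alpha> {} 2 - {0}) \<le> card A"
proof -
  let ?J = "extension (trunc_ideal G {} 2)" and ?K = "constants 2"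
  interpret J: cring "jet_ring 2" by (rule cring_jet_ring)
  have K: "subfield ?K (jet_ring 2)" by (rule subfield_constants) simp
  have A_max: "A \<subseteq> max_ideal" using genideal_self[OF A(2)] A(3) by simp
  obtain as where as: "set as = A" "distinct as" using finite_distinct_list[OF A(1)] by blast
  define Us where "Us = map (\<lambda>a. ?J +> a) as"
  have Us: "set Us \<subseteq> carrier (jet_ring 2)" using as A(2) by (auto simp: Us_def coset_hom)
  define T where "T = {x \<in> max_ideal. ?J +> x \<in> J.Span ?K Us}"
  have max_carr: "x \<in> max_ideal \<Longrightarrow> x \<in> carrier L" for x
    using ideal_max_ideal by (rule ideal.Icarr)
  \<comment> \<open>multiplication by \<open>r\<close> acts on the maximal ideal modulo its square as the constant term of \<open>r\<close>\<close>
  have "ideal T L"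
  proof (rule cring_idealI)
    show "T \<subseteq> carrier L" using max_carr by (auto simp: T_def)
    have "?J +> \<zero> = \<zero>\<^bsub>jet_ring 2\<^esub>" using jet_0[of 2] by (simp add: jet_def \<theta>_0)
    then show "\<zero> \<in> T"
      using ideal_max_ideal J.Span_subgroup_props(2)[OF K Us]
      by (simp add: T_def additive_subgroup.zero_closed ideal.axioms(1))
  next
    fix x y assume "x \<in> T" "y \<in> T"
    then show "x \<oplus> y \<in> T"
      using J.Span_subgroup_props(3)[OF K Us] ideal_max_ideal max_carr
      by (simp add: T_def coset_hom additive_subgroup.a_closed ideal.axioms(1))
  next
    fix r x assume r: "r \<in> carrier L" and x: "x \<in> T"
    then have xm: "x \<in> max_ideal" and xc: "x \<in> carrier L" using max_carr by (auto simp: T_def)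
    obtain f where f: "?J +> r = jet 2 f" using coset_eq_jet[OF r] by blast
    obtain g where g: "?J +> x = jet 2 g" using coset_eq_jet[OF xc] by blast
    have rx: "?J +> (r \<otimes> x) = jet 2 (f * g)" using r xc f g by (simp add: coset_hom jet_mult)
    have "?J +> x \<in> (\<lambda>x. ?J +> x) ` max_ideal" using xm by blast
    then obtain h where h: "jet 2 g = jet 2 h" "supp h \<subseteq> standard \<alpha> {} 2 - {0}"
      unfolding max_ideal_cosets[OF G one_le_numeral] g by blast
    have h0: "h \<in> trunc_ideal G {} 1" using h(2) G_0 by (subst trunc_ideal_1) (auto simp: in_keys_iff)
    have "f - poly_const (coef f 0) \<in> trunc_ideal G {} 1"
      using G_0 by (subst trunc_ideal_1) (auto simp: lookup_minus)
    from trunc_ideal_product[OF this h0]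
    have "(f - poly_const (coef f 0)) * h \<in> trunc_ideal G {} 2" by (simp add: numeral_2_eq_2)
    then have "jet 2 (f * h) = jet 2 (poly_const (coef f 0) * h)"
      unfolding jet_eq_iff by (simp add: algebra_simps)
    then have "?J +> (r \<otimes> x) = jet 2 (poly_const (coef f 0)) \<otimes>\<^bsub>jet_ring 2\<^esub> (?J +> x)"
      unfolding rx g by (simp add: jet_mult h(1))
    also have "\<dots> \<in> J.Span ?K Us"
      using x by (intro J.Span_smult_closed[OF K Us]) (auto simp: T_def)
    finally show "r \<otimes> x \<in> T"
      using r xm ideal.I_l_closed[OF ideal_max_ideal] by (simp add: T_def)
  qed
  moreover have "A \<subseteq> T"
    using A_max J.Span_base_incl[OF K Us] as by (auto simp: T_def Us_def)
  ultimately have "max_ideal \<subseteq> T" using genideal_minimal[of T A] A(3) by simp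
  then have sub: "(\<lambda>x. ?J +> x) ` max_ideal \<subseteq> J.Span ?K Us" by (auto simp: T_def)
  obtain d where d: "d \<le> length Us" "J.dimension d ?K (J.Span ?K Us)"
    using J.Span_dimension_le_length[OF K Us] by blast
  have "J.dimension (card (standard \<alpha> {} 2 - {0})) ?K ((\<lambda>x. ?J +> x) ` max_ideal)"
    using max_ideal_quotient_dimension_iff[OF G one_le_numeral] by blast
  from J.exists_base[OF K this] obtain Vs where Vs: "J.independent ?K Vs"
    "length Vs = card (standard \<alpha> {} 2 - {0})" "J.Span ?K Vs = (\<lambda>x. ?J +> x) ` max_ideal" "set Vs \<subseteq> carrier (jet_ring 2)"
    by blast
  have "set Vs \<subseteq> J.Span ?K Us" using J.Span_base_incl[OF K Vs(4)] Vs(3) sub by blast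
  then have "length Vs \<le> d" using J.independent_length_le_dimension[OF K d(2) Vs(1)] by blast
  also have "d \<le> card A" using d(1) as distinct_card[OF as(2)] by (simp add: Us_def)
  finally show ?thesis using Vs(2) by simp
qed

lemma min_gens_ge:
  assumes "initial G \<alpha>"
  shows "enat (card (standard \<alpha> {} 2 - {0})) \<le> min_gens L max_ideal"
  unfolding min_gens_def using card_generators_ge[OF assms] by (intro INF_greatest) auto

text \<open>
  The equation \<open>G = 0\<close> expresses the variable \<open>j\<close> by the others: the terms of \<open>G\<close> in which only \<open>j\<close>
  occurs sum up to \<open>U\<close> times that variable, where \<open>U\<close> has a non-zero constant term and hence is a unit
  in the local ring.
\<close>

lemma min_gens_le:
  assumes G: "initial G (unit_expon j)"
  shows "min_gens L max_ideal \<le> enat (CARD('s) - 1)"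
proof -
  define A where "A = (\<lambda>i. \<theta> (pvar i)) ` (UNIV - {j})"
  have A: "finite A" "A \<subseteq> carrier L" by (auto simp: A_def)
  have id: "ideal (Idl A) L" using A(2) by (rule genideal_ideal)
  define I where "I = contraction (Idl A)"
  have I: "poly_ideal I" unfolding I_def using id by (rule poly_ideal_contraction)
  have other: "pvar i \<in> I" if "i \<noteq> j" for i
    using genideal_self[OF A(2)] that by (auto simp: I_def contraction_def A_def)
  \<comment> \<open>\<open>g0\<close> collects the terms in which only the variable \<open>j\<close> occurs\<close>
  obtain g0 g1 where g: "G = g0 + g1"
    and g0: "supp g0 \<subseteq> supp G - {m. \<exists>i. i \<noteq> j \<and> 0 < expon m i}"
    and g1: "supp g1 \<subseteq> supp G \<inter> {m. \<exists>i. i \<noteq> j \<and> 0 < expon m i}"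
    by (rule supp_split)
  have "g1 \<in> I" using g1 other by (intro poly_ideal_var_multiples[OF I]) blast
  moreover have "G \<in> I"
    using id by (simp add: I_def contraction_def \<theta>_G additive_subgroup.zero_closed ideal.axioms(1))
  ultimately have "g0 \<in> I" using poly_idealD(4)[OF I, of G g1] by (simp add: g)
  define U where "U = (\<Sum>m\<in>supp g0. Poly_Mapping.single (m - unit_expon j) (coef g0 m))"
  have m_eq: "m = (m - unit_expon j) + unit_expon j" if "m \<in> supp g0" for m
  proof (rule divide_var)
    have "m \<noteq> 0" using that g0 G_0 by (auto simp: in_keys_iff)
    then obtain i where "0 < expon m i" using ex_expon_pos by blast
    moreover have "m \<notin> {m. \<exists>i. i \<noteq> j \<and> 0 < expon m i}" using that g0 by blast
    ultimately show "0 < expon m j" by (cases "i = j") auto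
  qed
  have "U * pvar j = (\<Sum>m\<in>supp g0. Poly_Mapping.single m (coef g0 m))"
    unfolding U_def sum_distrib_right by (intro sum.cong refl) (simp add: mult_single flip: m_eq)
  then have U: "U * pvar j = g0" by (simp flip: cpoly_sum_monos)
  have "coef g1 (unit_expon j) = 0"
  proof -
    have "unit_expon j \<notin> supp g1" using g1 by (auto simp: lookup_single when_def split: if_splits)
    then show ?thesis by (simp add: in_keys_iff)
  qed
  then have "coef g0 (unit_expon j) \<noteq> 0"
    using G by (simp add: g initial_def in_keys_iff lookup_add)
  moreover have "coef (U * pvar j) (0 + unit_expon j) = coef U 0 * coef (pvar j) (unit_expon j)"
    by (rule coef_mult_unique) auto
  ultimately have "coef U 0 \<noteq> 0" by (simp add: U)
  then have "\<theta> (pvar j) \<in> Idl A"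
    using \<open>g0 \<in> I\<close> ideal_unit_mult_iff[OF id, of "\<theta> (pvar j)" "\<theta> U"] \<theta>_unit m_comm[of "\<theta> U" "\<theta> (pvar j)"]
    by (simp add: I_def contraction_def \<theta>_mult flip: U)
  then have vars: "pvar i \<in> I" for i using other by (cases "i = j") (auto simp: I_def contraction_def)
  have "max_ideal \<subseteq> Idl A"
  proof (rule contraction_subset_imp_subset[OF ideal_max_ideal id], rule subsetI)
    fix f assume "f \<in> contraction max_ideal"
    then have f0: "coef f 0 = 0" by (simp add: contraction_def \<theta>_in_max_ideal_iff)
    have "f \<in> I"
    proof (rule poly_ideal_var_multiples[OF I])
      fix m assume "m \<in> supp f"
      then have "m \<noteq> 0" using f0 by (auto simp: in_keys_iff)
      then obtain i where "0 < expon m i" using ex_expon_pos by blast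
      then show "\<exists>v. 0 < expon m v \<and> pvar v \<in> I" using vars by blast
    qed
    then show "f \<in> contraction (Idl A)" by (simp add: I_def)
  qed
  moreover have "Idl A \<subseteq> max_ideal"
    by (intro genideal_minimal ideal_max_ideal) (auto simp: A_def \<theta>_in_max_ideal_iff coef_pvar_0)
  ultimately have "Idl A = max_ideal" by blast
  then have "min_gens L max_ideal \<le> enat (card A)"
    unfolding min_gens_def using A by (intro INF_lower) auto
  also have "card A \<le> CARD('s) - 1"
    unfolding A_def using card_image_le[of "UNIV - {j}" "\<lambda>i. \<theta> (pvar i)"] by simp
  finally show ?thesis by simp
qed

subsection \<open>The regularity criterion\<close>

text \<open>
  If \<open>\<alpha>\<close> is a variable, both sides hold.  If its degree is at least 2, both fail: all \<open>CARD('s)\<close> variables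
  are standard, so the maximal ideal needs more generators than the Krull dimension allows, and the
  monomials that avoid a variable \<open>j\<close> dividing \<open>\<alpha>\<close> are standard but do not exhaust the standard
  monomials, since \<open>j\<close> itself is standard.
\<close>

theorem regular_iff_card_standard:
  assumes G: "initial G \<alpha>" and n: "n \<ge> 1"
  shows "regular_local_ring L \<longleftrightarrow>
    ((n + CARD('s) - 1) choose (CARD('s) - 1)) - 1 = card (standard \<alpha> {} (n + 1) - {0})"
proof -
  have regular: "regular_local_ring L \<longleftrightarrow> min_gens L max_ideal = krull_dim L"
    unfolding regular_local_ring_def using local_ring noetherian maximalideal_iff by auto
  have \<alpha>: "\<alpha> \<noteq> 0" using G G_0 by (auto simp: initial_def in_keys_iff)
  have card_avoid: "card ({m :: 's \<Rightarrow>\<^sub>0 nat. tdeg m \<le> n \<and> expon m j = 0} - {0}) =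
      ((n + CARD('s) - 1) choose (CARD('s) - 1)) - 1" for n j
    by (simp add: card_deg_le_avoiding)
  show ?thesis
  proof (cases "tdeg \<alpha> = 1")
    case True
    then obtain j where j: "\<alpha> = unit_expon j" by (rule tdeg_eq_1E)
    have "card (standard \<alpha> {} 2 - {0}) = CARD('s) - 1"
      unfolding j numeral_2_eq_2 standard_unit_expon card_avoid by (cases "CARD('s)") simp_all
    then have "min_gens L max_ideal = krull_dim L"
      using min_gens_ge[OF G] min_gens_le krull_dim_le krull_dim_ge G unfolding j
      by (metis antisym)
    then show ?thesis
      using regular card_avoid[of n j] by (simp add: j standard_unit_expon)
  next
    case False
    with \<alpha> have deg2: "2 \<le> tdeg \<alpha>" using tdeg_pos_iff[of \<alpha>] by linarith
    have not_dvd: "\<not> mono_dvd \<alpha> m" if "tdeg m \<le> 1" for m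
    proof
      assume "mono_dvd \<alpha> m"
      then have "m = (m - \<alpha>) + \<alpha>" by (rule mono_dvd_diff)
      then have "tdeg \<alpha> \<le> tdeg m" by (metis tdeg_add le_add2)
      with deg2 that show False by simp
    qed
    have "card {m :: 's \<Rightarrow>\<^sub>0 nat. tdeg m = 1} = CARD('s)"
      using card_deg_eq[where 's = 's, of 1] by simp
    moreover have "{m. tdeg m = 1} \<subseteq> standard \<alpha> {} 2 - {0}"
      using not_dvd by (auto simp: standard_def tail_def)
    ultimately have "CARD('s) \<le> card (standard \<alpha> {} 2 - {0})"
      by (metis card_mono finite_Diff finite_standard)
    then have "enat (CARD('s)) \<le> min_gens L max_ideal"
      using min_gens_ge[OF G] by (meson enat_ord_simps(1) order_trans)
    moreover have "enat (CARD('s) - 1) < enat (CARD('s))" by simp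
    ultimately have "\<not> regular_local_ring L"
      unfolding regular using krull_dim_le by (metis leD order_less_le_trans)
    obtain j where j: "0 < expon \<alpha> j" using \<alpha> ex_expon_pos by blast
    have "{m. tdeg m \<le> n \<and> expon m j = 0} - {0} \<subset> standard \<alpha> {} (n + 1) - {0}"
    proof
      show "{m. tdeg m \<le> n \<and> expon m j = 0} - {0} \<subseteq> standard \<alpha> {} (n + 1) - {0}"
        using j by (auto simp: standard_def tail_def mono_dvd_def intro!: exI[of _ j])
      have "unit_expon j \<in> standard \<alpha> {} (n + 1) - {0}"
        using not_dvd[of "unit_expon j"] n tdeg_unit_expon[of j]
        by (auto simp: standard_def tail_def simp del: tdeg_unit_expon)
      moreover have "unit_expon j \<notin> {m. tdeg m \<le> n \<and> expon m j = 0} - {0}" by simp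
      ultimately show "{m. tdeg m \<le> n \<and> expon m j = 0} - {0} \<noteq> standard \<alpha> {} (n + 1) - {0}" by blast
    qed
    then have "card ({m. tdeg m \<le> n \<and> expon m j = 0} - {0}) < card (standard \<alpha> {} (n + 1) - {0})"
      by (intro psubset_card_mono) (auto simp: finite_standard)
    with \<open>\<not> regular_local_ring L\<close> show ?thesis by (simp add: card_avoid)
  qed
qed

end

section \<open>The local ring at a point of a hypersurface\<close>

lemma cring_poly_ring: "cring (poly_ring :: 's::finite cpoly ring)"
  by (rule cring_from_type_algebra)

lemma poly_ring_simps:
  "carrier (poly_ring :: 's::finite cpoly ring) = UNIV"
  "f \<otimes>\<^bsub>poly_ring\<^esub> g = f * (g :: 's::finite cpoly)"
  "f \<oplus>\<^bsub>poly_ring\<^esub> g = f + (g :: 's::finite cpoly)"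
  "\<one>\<^bsub>poly_ring\<^esub> = (1 :: 's::finite cpoly)"
  "\<zero>\<^bsub>poly_ring\<^esub> = (0 :: 's::finite cpoly)"
  by (simp_all add: ring_of_type_algebra_def)

lemma poly_ring_minus: "f \<ominus>\<^bsub>poly_ring\<^esub> g = f - (g :: 's::finite cpoly)"
proof -
  interpret P: cring "poly_ring :: 's cpoly ring" by (rule cring_poly_ring)
  have "\<ominus>\<^bsub>poly_ring\<^esub> g = - g"
    by (rule P.minus_equality) (simp_all add: poly_ring_simps)
  then show ?thesis by (simp add: a_minus_def poly_ring_simps)
qed

lemma Idl_poly_ring: "Idl\<^bsub>poly_ring\<^esub> {F :: 's::finite cpoly} = {a * F | a. True}"
proof -
  interpret P: cring "poly_ring :: 's cpoly ring" by (rule cring_poly_ring)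
  have "Idl\<^bsub>poly_ring\<^esub> {F} = PIdl\<^bsub>poly_ring\<^esub> F"
    by (rule P.cgenideal_eq_genideal[symmetric]) (simp add: poly_ring_simps)
  then show ?thesis by (simp add: cgenideal_def poly_ring_simps)
qed

locale hypersurface_point =
  fixes F :: "'s::finite cpoly" and p :: "complex ^ 's"
  assumes F_nonzero: "F \<noteq> 0" and F_p: "poly_eval F p = 0"
begin

abbreviation "R \<equiv> coord_ring F"
abbreviation "S \<equiv> point_compl F p"
abbreviation "res \<equiv> residue_class F"

lemma ideal_F: "ideal (Idl\<^bsub>poly_ring\<^esub> {F}) poly_ring"
proof -
  interpret P: cring "poly_ring :: 's cpoly ring" by (rule cring_poly_ring)
  show ?thesis by (rule P.genideal_ideal) (simp add: poly_ring_simps)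
qed

lemma cring_R: "cring R"
  unfolding coord_ring_def by (rule ideal.quotient_is_cring[OF ideal_F cring_poly_ring])

lemma res_hom: "res \<in> ring_hom poly_ring R"
  unfolding coord_ring_def residue_class_def by (rule ideal.rcos_ring_hom[OF ideal_F])

lemma res_closed: "res f \<in> carrier R"
  and res_mult: "res (f * g) = res f \<otimes>\<^bsub>R\<^esub> res g"
  and res_add: "res (f + g) = res f \<oplus>\<^bsub>R\<^esub> res g"
  and res_1: "res 1 = \<one>\<^bsub>R\<^esub>"
  using ring_hom_closed[OF res_hom] ring_hom_mult[OF res_hom] ring_hom_add[OF res_hom]
    ring_hom_one[OF res_hom] by (simp_all add: poly_ring_simps)

lemma carrier_R: "carrier R = range res"
  by (auto simp: coord_ring_def residue_class_def FactRing_def A_RCOSETS_def' poly_ring_simps)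

lemma res_eq_iff: "res f = res g \<longleftrightarrow> (\<exists>a. f - g = a * F)"
proof -
  interpret P: cring "poly_ring :: 's cpoly ring" by (rule cring_poly_ring)
  have "res f = res g \<longleftrightarrow> f \<ominus>\<^bsub>poly_ring\<^esub> g \<in> Idl\<^bsub>poly_ring\<^esub> {F}"
    unfolding residue_class_def
    by (rule P.quotient_eq_iff_same_a_r_cos[OF ideal_F, symmetric]) (simp_all add: poly_ring_simps)
  then show ?thesis by (auto simp: poly_ring_minus Idl_poly_ring)
qed

lemma res_0: "res 0 = \<zero>\<^bsub>R\<^esub>"
proof -
  interpret R: cring R by (rule cring_R)
  have "res 0 \<oplus>\<^bsub>R\<^esub> res 0 = res 0" by (simp flip: res_add)
  then show ?thesis using res_closed[of 0] by (metis R.add.l_cancel_one)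
qed

lemma res_in_point_ideal_iff: "res f \<in> point_ideal F p \<longleftrightarrow> poly_eval f p = 0"
proof
  assume "res f \<in> point_ideal F p"
  then obtain g where g: "poly_eval g p = 0" "res f = res g" unfolding point_ideal_def by blast
  then obtain a where "f - g = a * F" unfolding res_eq_iff by blast
  then have "f = a * F + g" by (simp add: algebra_simps)
  then show "poly_eval f p = 0" using g(1) F_p by (simp add: poly_eval_add poly_eval_mult)
qed (auto simp: point_ideal_def)

lemma res_in_S_iff: "res f \<in> S \<longleftrightarrow> poly_eval f p \<noteq> 0"
  using res_closed[of f] by (simp add: point_compl_def res_in_point_ideal_iff)

lemma S_res: "s \<in> S \<Longrightarrow> \<exists>g. s = res g \<and> poly_eval g p \<noteq> 0"
  using res_in_S_iff carrier_R unfolding point_compl_def by fastforce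

sublocale mult_subset R S
proof (intro mult_subset.intro cring_R, unfold_locales)
  show "S \<subseteq> carrier R" by (auto simp: point_compl_def)
  show "\<one>\<^bsub>R\<^esub> \<in> S" by (simp add: res_in_S_iff poly_eval_1 flip: res_1)
  fix s t assume "s \<in> S" "t \<in> S"
  then show "s \<otimes>\<^bsub>R\<^esub> t \<in> S"
    by (auto dest!: S_res simp: res_in_S_iff poly_eval_mult simp flip: res_mult)
qed

abbreviation "frac_at \<equiv> fraction R S"

text \<open>
  The canonical map in coordinates centred at \<open>p\<close>: a polynomial in the new coordinates is
  translated back before its germ at \<open>p\<close> is taken.
\<close>

definition \<theta> :: "'s cpoly \<Rightarrow> 's germ" where
  "\<theta> f = frac_at (res (translate (- p) f)) \<one>\<^bsub>R\<^esub>"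

lemma local_ring_at_eq: "local_ring_at F p = localization R S"
  by (simp add: local_ring_at_def)

lemma one_in_S: "\<one>\<^bsub>R\<^esub> \<in> S"
  by (rule S_one)

lemma translate_inverse: "translate (- p) (translate p f) = f"
  using translate_translate[of "- p" f] by simp

lemma poly_eval_translate_inverse: "poly_eval (translate (- p) u) p = coef u 0"
  using poly_eval_translate[of p "translate (- p) u"]
  by (simp add: translate_translate poly_eval_origin)

lemma coef_translate_0: "coef (translate p f) 0 = poly_eval f p"
  by (simp add: poly_eval_translate flip: poly_eval_origin)

lemma \<theta>_translate: "\<theta> (translate p f) = frac_at (res f) \<one>\<^bsub>R\<^esub>"
  by (simp add: \<theta>_def translate_inverse)

lemma frac_mult_denominator:
  assumes "a \<in> carrier R" "s \<in> S"
  shows "frac_at a s \<otimes>\<^bsub>local_ring_at F p\<^esub> frac_at s \<one>\<^bsub>R\<^esub> = frac_at a \<one>\<^bsub>R\<^esub>"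
proof -
  have "frac_at a s \<otimes>\<^bsub>local_ring_at F p\<^esub> frac_at s \<one>\<^bsub>R\<^esub> = frac_at (a \<otimes>\<^bsub>R\<^esub> s) (s \<otimes>\<^bsub>R\<^esub> \<one>\<^bsub>R\<^esub>)"
    unfolding local_ring_at_eq using assms one_in_S S_carr by (intro fraction_mult) auto
  also have "\<dots> = frac_at a \<one>\<^bsub>R\<^esub>"
    using assms S_carr one_in_S by (intro fraction_eqI) (auto simp: m_ac)
  finally show ?thesis .
qed

text \<open>
  The conditions on fractions are pulled back along the residue map, and values at \<open>p\<close> become
  constant terms after the translation.
\<close>

sublocale germ: hypersurface_germ "local_ring_at F p" \<theta> "translate p F"
proof (intro hypersurface_germ.intro hypersurface_germ_axioms.intro)
  show "cring (local_ring_at F p)" unfolding local_ring_at_eq by (rule cring_localization)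
  show "\<theta> f \<in> carrier (local_ring_at F p)" for f
    using res_closed one_in_S by (auto simp: \<theta>_def local_ring_at_eq carrier_localization)
  show "\<theta> (f + g) = \<theta> f \<oplus>\<^bsub>local_ring_at F p\<^esub> \<theta> g" for f g
    by (simp add: \<theta>_def local_ring_at_eq fraction_add res_closed one_in_S translate_add res_add)
  show "\<theta> (f * g) = \<theta> f \<otimes>\<^bsub>local_ring_at F p\<^esub> \<theta> g" for f g
    by (simp add: \<theta>_def local_ring_at_eq fraction_mult res_closed one_in_S translate_mult res_mult)
  show one: "\<theta> 1 = \<one>\<^bsub>local_ring_at F p\<^esub>"
    by (simp add: \<theta>_def local_ring_at_eq translate_1 res_1 localization_def)
  show "\<theta> u \<in> Units (local_ring_at F p)" if "coef u 0 \<noteq> 0" for u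
  proof -
    interpret L: cring "local_ring_at F p" unfolding local_ring_at_eq by (rule cring_localization)
    define s where "s = res (translate (- p) u)"
    have s: "s \<in> S" using that by (simp add: s_def res_in_S_iff poly_eval_translate_inverse)
    have "frac_at \<one>\<^bsub>R\<^esub> s \<otimes>\<^bsub>local_ring_at F p\<^esub> frac_at s \<one>\<^bsub>R\<^esub> = \<one>\<^bsub>local_ring_at F p\<^esub>"
      using frac_mult_denominator[of "\<one>\<^bsub>R\<^esub>" s] s by (simp add: local_ring_at_eq localization_def)
    moreover have "frac_at \<one>\<^bsub>R\<^esub> s \<in> carrier (local_ring_at F p)" "frac_at s \<one>\<^bsub>R\<^esub> \<in> carrier (local_ring_at F p)"
      using s S_carr one_in_S by (auto simp: local_ring_at_eq carrier_localization)
    ultimately have "frac_at s \<one>\<^bsub>R\<^esub> \<in> Units (local_ring_at F p)"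
      by (metis L.Units_one_closed L.m_comm L.unit_factor)
    then show ?thesis by (simp add: \<theta>_def s_def)
  qed
  show "\<exists>f u. coef u 0 \<noteq> 0 \<and> x \<otimes>\<^bsub>local_ring_at F p\<^esub> \<theta> u = \<theta> f"
    if x_carrier: "x \<in> carrier (local_ring_at F p)" for x
  proof -
    obtain a s where x: "x = frac_at a s" "a \<in> carrier R" "s \<in> S"
      using x_carrier by (auto simp: local_ring_at_eq carrier_localization)
    obtain f where f: "a = res f" using x(2) carrier_R by blast
    obtain g where g: "s = res g" "poly_eval g p \<noteq> 0" using S_res[OF x(3)] by blast
    have "x \<otimes>\<^bsub>local_ring_at F p\<^esub> \<theta> (translate p g) = \<theta> (translate p f)"
      using frac_mult_denominator[OF x(2,3)] by (simp add: \<theta>_translate x(1) f g(1))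
    moreover have "coef (translate p g) 0 \<noteq> 0" using g(2) by (simp add: coef_translate_0)
    ultimately show ?thesis by blast
  qed
  show "\<theta> f = \<zero>\<^bsub>local_ring_at F p\<^esub> \<longleftrightarrow> (\<exists>u a. coef u 0 \<noteq> 0 \<and> u * f = a * translate p F)" for f
  proof -
    have "\<theta> f = \<zero>\<^bsub>local_ring_at F p\<^esub> \<longleftrightarrow> (\<exists>s\<in>S. s \<otimes>\<^bsub>R\<^esub> res (translate (- p) f) = \<zero>\<^bsub>R\<^esub>)"
      using fraction_eq_iff[OF res_closed one_in_S zero_closed one_in_S, of "translate (- p) f"]
        res_closed S_carr by (simp add: \<theta>_def local_ring_at_eq localization_def)
    also have "\<dots> \<longleftrightarrow> (\<exists>g. poly_eval g p \<noteq> 0 \<and> res (g * translate (- p) f) = res 0)"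
      using S_res res_in_S_iff by (metis res_0 res_mult)
    also have "\<dots> \<longleftrightarrow> (\<exists>g a. poly_eval g p \<noteq> 0 \<and> g * translate (- p) f = a * F)"
      by (auto simp: res_eq_iff)
    also have "\<dots> \<longleftrightarrow> (\<exists>u a. coef u 0 \<noteq> 0 \<and> u * f = a * translate p F)"
    proof
      assume "\<exists>g a. poly_eval g p \<noteq> 0 \<and> g * translate (- p) f = a * F"
      then obtain g a where g: "poly_eval g p \<noteq> 0" "g * translate (- p) f = a * F" by blast
      have "translate p g * f = translate p a * translate p F"
        using arg_cong[OF g(2), of "translate p"] by (simp add: translate_mult translate_translate)
      then show "\<exists>u a. coef u 0 \<noteq> 0 \<and> u * f = a * translate p F"
        using g(1) coef_translate_0 by metis
    next
      assume "\<exists>u a. coef u 0 \<noteq> 0 \<and> u * f = a * translate p F"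
      then obtain u a where u: "coef u 0 \<noteq> 0" "u * f = a * translate p F" by blast
      have "translate (- p) u * translate (- p) f = translate (- p) a * F"
        using arg_cong[OF u(2), of "translate (- p)"] by (simp add: translate_mult translate_inverse)
      then show "\<exists>g a. poly_eval g p \<noteq> 0 \<and> g * translate (- p) f = a * F"
        using u(1) poly_eval_translate_inverse by metis
    qed
    finally show ?thesis .
  qed
  show "translate p F \<noteq> 0"
  proof
    assume "translate p F = 0"
    then have "F = translate (- p) 0" using translate_inverse[of F] by simp
    also have "translate (- p) 0 = (0 :: 's cpoly)" using translate_const[of "- p" 0] by simp
    finally show False using F_nonzero by simp
  qed
  show "coef (translate p F) 0 = 0" by (simp add: coef_translate_0 F_p)
qed

lemma max_ideal_at_eq: "max_ideal_at F p = germ.max_ideal"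
proof -
  have mem: "frac_at (res f) (res g) \<in> germ.max_ideal \<longleftrightarrow> poly_eval f p = 0"
    if "poly_eval g p \<noteq> 0" for f g
  proof -
    have g: "res g \<in> S" using that by (simp add: res_in_S_iff)
    have "frac_at (res f) (res g) \<in> carrier (local_ring_at F p)"
      using g res_closed by (auto simp: local_ring_at_eq carrier_localization)
    moreover have "frac_at (res f) (res g) \<otimes>\<^bsub>local_ring_at F p\<^esub> \<theta> (translate p g) = \<theta> (translate p f)"
      using frac_mult_denominator[OF res_closed g] by (simp add: \<theta>_translate)
    ultimately show ?thesis
      using germ.fraction_mem_max_ideal_iff[of _ "translate p g" "translate p f"] that
      by (simp add: coef_translate_0)
  qed
  show ?thesis
  proof (intro equalityI subsetI)
    fix x assume "x \<in> max_ideal_at F p"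
    then obtain f s where x: "x = frac_at (res f) s" "poly_eval f p = 0" "s \<in> S"
      unfolding max_ideal_at_def point_ideal_def by blast
    then show "x \<in> germ.max_ideal" using S_res mem by blast
  next
    fix x assume x: "x \<in> germ.max_ideal"
    then have "x \<in> carrier (local_ring_at F p)" using germ.ideal_max_ideal by (rule ideal.Icarr[rotated])
    then obtain a s where as: "x = frac_at a s" "a \<in> carrier R" "s \<in> S"
      unfolding local_ring_at_eq carrier_localization by blast
    obtain f where f: "a = res f" using as(2) carrier_R by blast
    obtain g where g: "s = res g" "poly_eval g p \<noteq> 0" using S_res[OF as(3)] by blast
    have "poly_eval f p = 0" using x mem[OF g(2)] by (simp add: as(1) f g(1))
    then have "a \<in> point_ideal F p" by (simp add: f res_in_point_ideal_iff)
    then show "x \<in> max_ideal_at F p" unfolding max_ideal_at_def using as by blast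
  qed
qed

lemma max_ideal_quotient_dim_iff:
  assumes "initial (translate p F) \<alpha>" "k \<ge> 1"
  shows "max_ideal_quotient_dim F p k d \<longleftrightarrow> d = card (standard \<alpha> {} k - {0})"
proof -
  have "const_germ F p c = \<theta> (poly_const c)" for c
    by (simp add: const_germ_def \<theta>_def translate_const)
  moreover have "max_ideal_pow F p k = germ.extension (trunc_ideal (translate p F) {} k)"
    unfolding max_ideal_pow_def max_ideal_at_eq by (rule germ.max_ideal_pow)
  ultimately show ?thesis
    unfolding max_ideal_quotient_dim_def Let_def max_ideal_at_eq
    using germ.max_ideal_quotient_dimension_iff[OF assms] by (simp add: germ.jet_def)
qed

end

theorem corollary2p7:
  fixes F :: "'s::finite cpoly" and p :: "complex ^ 's" and n :: nat
  assumes "n \<ge> 1"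
    and "\<forall>c. F \<noteq> poly_const c"
    and "p \<in> zero_locus F"
  shows "nonsingular_point F p \<longleftrightarrow>
    max_ideal_quotient_dim F p (n + 1) (((n + CARD('s) - 1) choose (CARD('s) - 1)) - 1)"
proof -
  interpret hypersurface_point F p
    using assms(2)[rule_format, of 0] assms(3) by unfold_locales (simp_all add: zero_locus_def)
  obtain \<alpha> where \<alpha>: "initial (translate p F) \<alpha>" using germ.G_nonzero by (rule ex_initial)
  show ?thesis
    unfolding nonsingular_point_def max_ideal_quotient_dim_iff[OF \<alpha> le_add2]
    by (rule germ.regular_iff_card_standard[OF \<alpha> assms(1)])
qed

end
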